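(* Let $\{\Phi_t\}_{t\ge0}$ be a quantum dynamical semigroup of unital quantum channels on $M_d$. Then there exists $t_0\ge0$ such that $\Phi_t$ is a mixed unitary channel for every $t\ge t_0$.
   Context: A quantum dynamical semigroup of unital quantum channels is a family $\{\Phi_t\}_{t\ge0}$ of completely positive, unital, trace-preserving linear maps on $M_d$ with $\Phi_0=\mathrm{id}$, $\Phi_s\Phi_t=\Phi_{s+t}$ and $t\mapsto\Phi_t$ continuous. A unital quantum channel is mixed unitary if it equals $\sum_{j=1}^\ell\lambda_j\mathrm{Ad}_{U_j}$ with unitaries $U_j$, $\lambda_j\ge0$, $\sum_j\lambda_j=1$, where $\mathrm{Ad}_U(X)=U^*XU$. *)

theory Defs
  imports "HOL-Analysis.Analysis"
begin

definition cmat_smult :: "complex \<Rightarrow> complex^'d^'d \<Rightarrow> complex^'d^'d" where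
  "cmat_smult c A = (\<chi> i j. c * A $ i $ j)"

definition adjoint_mat :: "complex^'d^'d \<Rightarrow> complex^'d^'d" where
  "adjoint_mat A = (\<chi> i j. cnj (A $ j $ i))"

definition unitary_mat :: "complex^'d^'d \<Rightarrow> bool" where
  "unitary_mat U \<longleftrightarrow> U ** adjoint_mat U = mat 1 \<and> adjoint_mat U ** U = mat 1"

definition Ad :: "complex^'d^'d \<Rightarrow> complex^'d^'d \<Rightarrow> complex^'d^'d" where
  "Ad U X = adjoint_mat U ** X ** U"

definition clinear_map :: "(complex^'d^'d \<Rightarrow> complex^'d^'d) \<Rightarrow> bool" where
  "clinear_map \<Phi> \<longleftrightarrow> (\<forall>X Y. \<Phi> (X + Y) = \<Phi> X + \<Phi> Y) \<and>
                        (\<forall>c X. \<Phi> (cmat_smult c X) = cmat_smult c (\<Phi> X))"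

text \<open>Positive semidefiniteness of a k x k block matrix [X i j] in M_k(M_d), written out:
  for every vector v = (v_0,...,v_{k-1}) in (C^d)^k, v^* [X i j] v is real and nonnegative.\<close>
definition block_psd :: "nat \<Rightarrow> (nat \<Rightarrow> nat \<Rightarrow> complex^'d^'d) \<Rightarrow> bool" where
  "block_psd k X \<longleftrightarrow> (\<forall>v :: nat \<Rightarrow> complex^'d.
     let q = (\<Sum>i<k. \<Sum>j<k. \<Sum>a\<in>UNIV. \<Sum>b\<in>UNIV. cnj (v i $ a) * X i j $ a $ b * v j $ b)
     in Im q = 0 \<and> Re q \<ge> 0)"

text \<open>Complete positivity: id_{M_k} \<otimes> \<Phi> is positive on M_k(M_d) for every k.\<close>
definition completely_positive :: "(complex^'d^'d \<Rightarrow> complex^'d^'d) \<Rightarrow> bool" where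
  "completely_positive \<Phi> \<longleftrightarrow>
     (\<forall>k X. block_psd k X \<longrightarrow> block_psd k (\<lambda>i j. \<Phi> (X i j)))"

definition unital_channel :: "(complex^'d^'d \<Rightarrow> complex^'d^'d) \<Rightarrow> bool" where
  "unital_channel \<Phi> \<longleftrightarrow> clinear_map \<Phi> \<and> completely_positive \<Phi> \<and>
     \<Phi> (mat 1) = mat 1 \<and> (\<forall>X. trace (\<Phi> X) = trace X)"

definition quantum_dynamical_semigroup :: "(real \<Rightarrow> complex^'d^'d \<Rightarrow> complex^'d^'d) \<Rightarrow> bool" where
  "quantum_dynamical_semigroup \<Phi> \<longleftrightarrow>
     (\<forall>t\<ge>0. unital_channel (\<Phi> t)) \<and>
     \<Phi> 0 = id \<and>
     (\<forall>s\<ge>0. \<forall>t\<ge>0. \<Phi> s \<circ> \<Phi> t = \<Phi> (s + t)) \<and>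
     (\<forall>X. continuous_on {0..} (\<lambda>t. \<Phi> t X))"

definition mixed_unitary :: "(complex^'d^'d \<Rightarrow> complex^'d^'d) \<Rightarrow> bool" where
  "mixed_unitary \<Phi> \<longleftrightarrow> (\<exists>(l::nat) (w::nat \<Rightarrow> real) (U::nat \<Rightarrow> complex^'d^'d).
     (\<forall>j<l. w j \<ge> 0 \<and> unitary_mat (U j)) \<and> (\<Sum>j<l. w j) = 1 \<and>
     (\<forall>X. \<Phi> X = (\<Sum>j<l. w j *\<^sub>R Ad (U j) X)))"

end

theory Submission
  imports Defs
begin

text \<open>
  The matrices \<open>X\<close> with \<open>\<parallel>\<Phi>\<^sub>t X\<parallel> = \<parallel>X\<parallel>\<close> for all \<open>t\<close> (Hilbert-Schmidt norm) form a *-algebra \<open>N\<close>: by the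
  Schwarz inequality they are the common multiplicative domain of the \<open>\<Phi>\<^sub>t\<close>. On the orthogonal complement
  of \<open>N\<close> the semigroup tends to 0. On \<open>N\<close> it acts by *-automorphisms; those close to the identity are
  implemented by unitaries, hence so are all, as powers of these. Undoing the unitary turns \<open>\<Phi>\<^sub>t\<close> into an
  \<open>N\<close>-bimodule map \<open>T\<^sub>t = \<Sum>\<^sub>k a\<^sub>k X b\<^sub>k\<close> with \<open>a\<^sub>k, b\<^sub>k\<close> in the commutant \<open>B\<close> of \<open>N\<close>, and \<open>T\<^sub>t\<close> tends to the
  average \<open>E\<close> of the conjugations by unitaries of \<open>B\<close>.

  The group-invariant average \<open>E\<close> lies in the relative interior of the convex hull of these conjugations, so
  it remains to see that \<open>T\<^sub>t\<close> lies in their affine hull. Differentiating along unitaries puts the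
  commutator maps \<open>ad\<^sub>Y\<close>, \<open>Y \<in> B\<close>, into the complex span \<open>D\<close> of differences of conjugations, which is closed
  under composition. Averaging an identity between products of three commutators gives
  \<open>z X y \<equiv> z y X + E (X (y z - z y))\<close> modulo \<open>D\<close>, and unitality and trace preservation then give
  \<open>T\<^sub>t \<equiv> id\<close>.
\<close>

section \<open>Complex matrices with the Frobenius norm\<close>

type_synonym 'd cmat = "complex^'d^'d"

abbreviation adj :: "'d::finite cmat \<Rightarrow> 'd cmat" where "adj \<equiv> adjoint_mat"
abbreviation sm :: "complex \<Rightarrow> 'd::finite cmat \<Rightarrow> 'd cmat" where "sm \<equiv> cmat_smult"

lemma norm_cmat_power2: "(norm (A::'d::finite cmat))\<^sup>2 = (\<Sum>i\<in>UNIV. \<Sum>j\<in>UNIV. (cmod (A $ i $ j))\<^sup>2)"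
  by (simp add: norm_vec_def L2_set_def sum_nonneg)

text \<open>Cauchy-Schwarz bounds each entry of the product by a row norm times a column norm; the
  sum of the squares over all entries then factorises.\<close>

lemma norm_cmat_mult: "norm (A ** B) \<le> norm (A::'d::finite cmat) * norm (B::'d cmat)"
proof -
  have "(norm (A ** B))\<^sup>2 \<le> (norm A * norm B)\<^sup>2"
  proof -
    have *: "(cmod ((A ** B) $ i $ j))\<^sup>2 \<le> (\<Sum>k\<in>UNIV. (cmod (A $ i $ k))\<^sup>2) * (\<Sum>k\<in>UNIV. (cmod (B $ k $ j))\<^sup>2)" for i j
    proof -
      have "cmod ((A ** B) $ i $ j) \<le> (\<Sum>k\<in>UNIV. cmod (A $ i $ k * B $ k $ j))"
        unfolding matrix_matrix_mult_def by (simp add: norm_sum)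
      also have "\<dots> \<le> L2_set (\<lambda>k. cmod (A $ i $ k)) UNIV * L2_set (\<lambda>k. cmod (B $ k $ j)) UNIV"
        using L2_set_mult_ineq[of "\<lambda>k. cmod (A $ i $ k)" "\<lambda>k. cmod (B $ k $ j)" UNIV]
        by (simp add: norm_mult)
      finally have "(cmod ((A ** B) $ i $ j))\<^sup>2 \<le> (L2_set (\<lambda>k. cmod (A $ i $ k)) UNIV * L2_set (\<lambda>k. cmod (B $ k $ j)) UNIV)\<^sup>2"
        by (rule power_mono) simp
      then show ?thesis
        by (simp add: power_mult_distrib L2_set_def sum_nonneg)
    qed
    have "(norm (A ** B))\<^sup>2 \<le> (\<Sum>i\<in>UNIV. \<Sum>j\<in>UNIV. (\<Sum>k\<in>UNIV. (cmod (A $ i $ k))\<^sup>2) * (\<Sum>k\<in>UNIV. (cmod (B $ k $ j))\<^sup>2))"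
      unfolding norm_cmat_power2[of "A ** B"] by (intro sum_mono *)
    also have "\<dots> = (norm A)\<^sup>2 * (norm B)\<^sup>2"
      unfolding norm_cmat_power2 sum.swap[of "\<lambda>i j. (cmod (B $ i $ j))\<^sup>2"] sum_product by simp
    finally show ?thesis by (simp add: power_mult_distrib)
  qed
  then show ?thesis by (rule power2_le_imp_le) simp
qed

interpretation mm: bounded_bilinear "(**) :: 'd::finite cmat \<Rightarrow> 'd cmat \<Rightarrow> 'd cmat"
proof
  fix A A' B B' :: "'d cmat" and r :: real
  show "(A + A') ** B = A ** B + A' ** B"
    by (simp add: vec_eq_iff matrix_matrix_mult_def sum.distrib algebra_simps)
  show "A ** (B + B') = A ** B + A ** B'"
    by (simp add: vec_eq_iff matrix_matrix_mult_def sum.distrib algebra_simps)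
  show "(r *\<^sub>R A) ** B = r *\<^sub>R (A ** B)"
    by (simp add: vec_eq_iff matrix_matrix_mult_def sum_distrib_left scaleR_sum_right)
  show "A ** (r *\<^sub>R B) = r *\<^sub>R (A ** B)"
    by (simp add: vec_eq_iff matrix_matrix_mult_def sum_distrib_left scaleR_sum_right)
  show "\<exists>K. \<forall>(a :: 'd cmat) (b :: 'd cmat). norm (a ** b) \<le> norm a * norm b * K"
    by (rule exI[of _ 1]) (simp add: norm_cmat_mult del: ex_simps)
qed

lemma norm_adj [simp]: "norm (adj (A::'d::finite cmat)) = norm A"
proof -
  have "(norm (adj A))\<^sup>2 = (norm A)\<^sup>2"
    unfolding norm_cmat_power2 by (subst sum.swap) (simp add: adjoint_mat_def)
  then show ?thesis by simp
qed

lemma bounded_linear_adj: "bounded_linear (adj :: 'd::finite cmat \<Rightarrow> 'd cmat)"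
proof
  show "\<exists>K. \<forall>A::'d cmat. norm (adj A) \<le> norm A * K"
    by (rule exI[of _ 1]) simp
qed (simp_all add: vec_eq_iff adjoint_mat_def)

lemma norm_sm [simp]: "norm (sm c A) = cmod c * norm (A::'d::finite cmat)"
proof -
  have "(norm (sm c A))\<^sup>2 = (cmod c * norm A)\<^sup>2"
    by (simp add: norm_cmat_power2 power_mult_distrib cmat_smult_def norm_mult sum_distrib_left)
  then show ?thesis by (simp add: power2_eq_iff_nonneg)
qed

interpretation sm: bounded_bilinear "sm :: complex \<Rightarrow> 'd::finite cmat \<Rightarrow> 'd cmat"
proof
  show "\<exists>K. \<forall>c A. norm (sm c (A::'d cmat)) \<le> norm c * norm A * K"
    by (rule exI[of _ 1]) simp
qed (simp_all add: vec_eq_iff cmat_smult_def algebra_simps)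

lemmas adj_linear = linear_add[OF bounded_linear.linear[OF bounded_linear_adj]]
  linear_diff[OF bounded_linear.linear[OF bounded_linear_adj]]
  linear_neg[OF bounded_linear.linear[OF bounded_linear_adj]]
  linear_sum[OF bounded_linear.linear[OF bounded_linear_adj]]
  linear_scale[OF bounded_linear.linear[OF bounded_linear_adj]]

lemma adj_adj [simp]: "adj (adj A) = (A::'d::finite cmat)"
  by (simp add: adjoint_mat_def vec_eq_iff)

lemma adj_mul: "adj (A ** B) = adj B ** adj (A::'d::finite cmat)"
  by (simp add: vec_eq_iff adjoint_mat_def matrix_matrix_mult_def mult.commute)

lemma adj_sm: "adj (sm c A) = sm (cnj c) (adj (A::'d::finite cmat))"
  by (simp add: adjoint_mat_def vec_eq_iff cmat_smult_def)

lemma adj_one [simp]: "adj (mat 1 :: 'd::finite cmat) = mat 1"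
  by (simp add: adjoint_mat_def vec_eq_iff mat_def)

lemma sm_sm [simp]: "sm a (sm b A) = sm (a * b) (A::'d::finite cmat)"
  by (simp add: vec_eq_iff cmat_smult_def mult.assoc)

lemma sm_one [simp]: "sm 1 A = (A::'d::finite cmat)"
  by (simp add: vec_eq_iff cmat_smult_def)

lemma sm_minus_one: "sm (-1) A = - (A::'d::finite cmat)"
  by (simp add: vec_eq_iff cmat_smult_def)

lemma scaleR_eq_sm: "r *\<^sub>R A = sm (complex_of_real r) (A::'d::finite cmat)"
  by (simp add: vec_eq_iff cmat_smult_def) (simp add: scaleR_conv_of_real)

lemma sm_scaleR: "sm c (r *\<^sub>R A) = r *\<^sub>R sm c (A::'d::finite cmat)"
  by (rule sm.scaleR_right)

lemma mul_sm_left: "sm c A ** B = sm c (A ** (B::'d::finite cmat))"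
  by (simp add: vec_eq_iff cmat_smult_def matrix_matrix_mult_def sum_distrib_left mult_ac)

lemma mul_sm_right: "A ** sm c B = sm c (A ** (B::'d::finite cmat))"
  by (simp add: vec_eq_iff cmat_smult_def matrix_matrix_mult_def sum_distrib_left mult_ac)

lemmas cmat_simps = mm.add_left mm.add_right mm.diff_left mm.diff_right mm.minus_left mm.minus_right
  mm.scaleR_left mm.scaleR_right mm.sum_left mm.sum_right mul_sm_left mul_sm_right
  adj_linear adj_mul adj_sm matrix_mul_assoc
  sm.add_right sm.diff_right sm.minus_right sm.sum_right sm_scaleR

section \<open>Trace and the Hilbert-Schmidt inner product\<close>

lemma trace_add_cmat: "trace (A + B) = trace A + trace (B::'d::finite cmat)"
  by (simp add: trace_def sum.distrib)
lemma trace_diff_cmat: "trace (A - B) = trace A - trace (B::'d::finite cmat)"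
  by (simp add: trace_def sum_subtractf)
lemma trace_sm: "trace (sm c A) = c * trace (A::'d::finite cmat)"
  by (simp add: trace_def cmat_smult_def sum_distrib_left)
lemma trace_sum: "trace (\<Sum>i\<in>I. A i :: 'd::finite cmat) = (\<Sum>i\<in>I. trace (A i))"
  by (simp add: trace_def sum.swap[of _ I])
lemma trace_adj_mul: "trace (adj A ** B) = (\<Sum>i\<in>UNIV. \<Sum>j\<in>UNIV. cnj (A $ i $ j) * (B::'d::finite cmat) $ i $ j)"
  unfolding trace_def matrix_matrix_mult_def adjoint_mat_def
  by (subst sum.swap) simp

lemma inner_cmat: "A \<bullet> B = Re (trace (adj A ** (B::'d::finite cmat)))"
  unfolding trace_adj_mul by (simp add: inner_vec_def inner_complex_def)

lemma norm_cmat_trace: "of_real ((norm A)\<^sup>2) = trace (adj A ** (A::'d::finite cmat))"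
  unfolding trace_adj_mul norm_cmat_power2
  by (simp add: complex_norm_square mult.commute del: of_real_power)

text \<open>The trace pairing is nondegenerate: test with \<open>Y = adj (A - B)\<close>.\<close>

lemma cmat_eqI_trace:
  assumes "\<And>Y. trace (Y ** A) = trace (Y ** (B::'d::finite cmat))"
  shows "A = B"
proof -
  have "trace (adj (A - B) ** (A - B)) = 0"
    using assms by (simp add: mm.diff_right trace_diff_cmat)
  then have "of_real ((norm (A - B))\<^sup>2) = (0::complex)"
    by (simp only: norm_cmat_trace)
  then show ?thesis by simp
qed

section \<open>Unitary matrices and their conjugations\<close>

lemma unitary_matI: "adj U ** U = mat 1 \<Longrightarrow> unitary_mat (U::'d::finite cmat)"
  unfolding unitary_mat_def using matrix_left_right_inverse by blast

lemma unitary_matD: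
  assumes "unitary_mat (U::'d::finite cmat)"
  shows "adj U ** U = mat 1" "U ** adj U = mat 1"
    "(A::'d cmat) ** U ** adj U = A" "A ** adj U ** U = A"
  using assms by (simp_all add: unitary_mat_def flip: matrix_mul_assoc)

lemma unitary_mat_one: "unitary_mat (mat 1 :: 'd::finite cmat)"
  by (simp add: unitary_mat_def)

lemma unitary_mat_mul: "unitary_mat U \<Longrightarrow> unitary_mat V \<Longrightarrow> unitary_mat (U ** (V::'d::finite cmat))"
  by (rule unitary_matI) (simp add: adj_mul matrix_mul_assoc unitary_matD)

lemma unitary_mat_adj: "unitary_mat U \<Longrightarrow> unitary_mat (adj (U::'d::finite cmat))"
  by (simp add: unitary_mat_def)

lemma norm_unitary_mul:
  assumes "unitary_mat (U::'d::finite cmat)"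
  shows "norm (U ** A) = norm A" "norm (A ** U) = norm A"
proof -
  have *: "norm (V ** A) = norm A" if "unitary_mat V" for V A :: "'d cmat"
  proof -
    have "of_real ((norm (V ** A))\<^sup>2) = (of_real ((norm A)\<^sup>2) :: complex)"
      unfolding norm_cmat_trace using that by (simp add: adj_mul matrix_mul_assoc unitary_matD)
    then show ?thesis by (simp only: of_real_eq_iff power2_eq_iff_nonneg norm_ge_zero)
  qed
  from assms show "norm (U ** A) = norm A" by (rule *)
  have "norm (adj (A ** U)) = norm (adj A)"
    using *[OF unitary_mat_adj[OF assms]] by (simp add: adj_mul)
  then show "norm (A ** U) = norm A" by simp
qed

lemma norm_unitary: "unitary_mat (U::'d::finite cmat) \<Longrightarrow> norm U = norm (mat 1 :: 'd cmat)"
  using norm_unitary_mul(1)[of U "mat 1"] by simp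

lemma norm_Ad: "unitary_mat (U::'d::finite cmat) \<Longrightarrow> norm (Ad U X) = norm X"
  by (simp add: Ad_def norm_unitary_mul unitary_mat_adj)

lemma Ad_comp: "Ad U (Ad V X) = Ad (V ** U) (X::'d::finite cmat)"
  by (simp add: Ad_def adj_mul matrix_mul_assoc)

lemma Ad_one [simp]: "Ad (mat 1) X = (X::'d::finite cmat)"
  by (simp add: Ad_def)

lemma adj_Ad: "adj (Ad U X) = Ad U (adj (X::'d::finite cmat))"
  by (simp add: Ad_def cmat_simps)

section \<open>Unitaries in *-algebras of matrices\<close>

definition star_algebra :: "'d::finite cmat set \<Rightarrow> bool" where
  "star_algebra B \<longleftrightarrow> mat 1 \<in> B \<and> (\<forall>X\<in>B. \<forall>Y\<in>B. X + Y \<in> B \<and> X ** Y \<in> B) \<and>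
     (\<forall>X\<in>B. adj X \<in> B \<and> (\<forall>c. sm c X \<in> B))"

definition unitaries :: "'d::finite cmat set \<Rightarrow> 'd cmat set" where
  "unitaries B = {U \<in> B. unitary_mat U}"

lemma star_algebraD:
  assumes "star_algebra B"
  shows "mat 1 \<in> B" "X \<in> B \<Longrightarrow> Y \<in> B \<Longrightarrow> X + Y \<in> B" "X \<in> B \<Longrightarrow> Y \<in> B \<Longrightarrow> X ** Y \<in> B"
    "X \<in> B \<Longrightarrow> adj X \<in> B" "X \<in> B \<Longrightarrow> sm c X \<in> B" "X \<in> B \<Longrightarrow> Y \<in> B \<Longrightarrow> X - Y \<in> B"
    "X \<in> B \<Longrightarrow> r *\<^sub>R X \<in> B" "0 \<in> B"
proof -
  show 1: "mat 1 \<in> B" and 2: "\<And>X Y. X \<in> B \<Longrightarrow> Y \<in> B \<Longrightarrow> X + Y \<in> B"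
    and "X \<in> B \<Longrightarrow> Y \<in> B \<Longrightarrow> X ** Y \<in> B" and "X \<in> B \<Longrightarrow> adj X \<in> B"
    and 3: "\<And>X c. X \<in> B \<Longrightarrow> sm c X \<in> B" for X Y
    using assms by (simp_all add: star_algebra_def)
  show "X \<in> B \<Longrightarrow> Y \<in> B \<Longrightarrow> X - Y \<in> B"
    using 2[of X "sm (-1) Y"] 3[of Y "-1"] by (simp add: sm_minus_one)
  show "X \<in> B \<Longrightarrow> r *\<^sub>R X \<in> B"
    using 3 by (simp only: scaleR_eq_sm)
  show "0 \<in> B"
    using 3[OF 1, of 0] by (simp add: sm.zero_left)
qed

lemma subspace_star_algebra: "star_algebra B \<Longrightarrow> subspace B"
  by (simp add: subspace_def star_algebraD)

lemma star_algebra_sum: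
  assumes "star_algebra B" "\<And>i. i \<in> I \<Longrightarrow> f i \<in> B"
  shows "(\<Sum>i\<in>I. f i) \<in> B"
  by (rule subspace_sum[OF subspace_star_algebra[OF assms(1)] assms(2)])

lemma unitariesD:
  assumes "star_algebra B"
  shows "mat 1 \<in> unitaries B" "U \<in> unitaries B \<Longrightarrow> U \<in> B" "U \<in> unitaries B \<Longrightarrow> unitary_mat U"
    "U \<in> unitaries B \<Longrightarrow> V \<in> unitaries B \<Longrightarrow> U ** V \<in> unitaries B"
    "U \<in> unitaries B \<Longrightarrow> adj U \<in> unitaries B"
  using assms by (auto simp: unitaries_def star_algebraD unitary_mat_one unitary_mat_mul unitary_mat_adj)

lemma compact_unitaries:
  assumes "star_algebra B"
  shows "compact (unitaries B)"
proof -
  have "bounded (unitaries B)"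
    unfolding bounded_iff by (rule exI[of _ "norm (mat 1 :: 'a cmat)"]) (auto simp: unitaries_def norm_unitary)
  moreover have "closed (unitaries B)"
  proof -
    have "closed {U::'a cmat. adj U ** U = mat 1}"
      by (intro closed_Collect_eq mm.continuous_on continuous_on_id continuous_on_const
          linear_continuous_on[OF bounded_linear_adj])
    then have "closed (B \<inter> {U. adj U ** U = mat 1})"
      using closed_subspace[OF subspace_star_algebra[OF assms]] by (rule closed_Int[rotated])
    moreover have "unitaries B = B \<inter> {U. adj U ** U = mat 1}"
      by (auto simp: unitaries_def unitary_matI unitary_matD)
    ultimately show ?thesis by simp
  qed
  ultimately show ?thesis by (simp add: compact_eq_bounded_closed)
qed

section \<open>Unitaries of an algebra near the identity\<close>

text \<open>The unitary is \<open>(1 + i s H) / (1 - i s H)\<close>, stated with the denominator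
  cleared. Like the exponential of \<open>2 i s H\<close>, it leaves the identity in direction
  \<open>2 i H\<close> without leaving \<open>B\<close>, but linear algebra suffices to construct
  it.\<close>

lemma Cayley_transform:
  assumes B: "star_algebra B" and H: "H \<in> B" "adj H = H"
  obtains U where "U \<in> unitaries B" "U - mat 1 = sm (\<i> * of_real s) (H ** (mat 1 + U))"
proof -
  define A where "A = mat 1 - sm (\<i> * of_real s) H"
  define A' where "A' = mat 1 + sm (\<i> * of_real s) H"
  have A: "A \<in> B" "A' \<in> B" "adj A = A'" "adj A' = A" "A ** A' = A' ** A"
    by (simp_all add: A_def A'_def H star_algebraD[OF B] cmat_simps sm.minus_left)
  \<comment> \<open>\<open>A' ** A\<close> is \<open>1 + s^2 H^2\<close>, so
    \<open>A ** X = 0\<close> makes a sum of two squared norms vanish.\<close>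
  have inj: "X = 0" if "A ** X = 0" for X :: "'a cmat"
  proof -
    have "adj X ** (A' ** A) ** X = adj X ** X + adj (s *\<^sub>R (H ** X)) ** (s *\<^sub>R (H ** X))"
      by (simp add: A_def A'_def cmat_simps H) (simp add: scaleR_eq_sm mult_ac flip: sm.minus_left)
    moreover have "adj X ** (A' ** A) ** X = 0"
      using that by (simp add: mm.zero_right flip: matrix_mul_assoc)
    ultimately have "trace (adj X ** X) + trace (adj (s *\<^sub>R (H ** X)) ** (s *\<^sub>R (H ** X))) = 0"
      by (simp flip: trace_add_cmat) (simp add: trace_def)
    then have "complex_of_real ((norm X)\<^sup>2 + (norm (s *\<^sub>R (H ** X)))\<^sup>2) = 0"
      unfolding of_real_add norm_cmat_trace .
    then show ?thesis
      by (simp only: of_real_eq_0_iff) (simp add: add_nonneg_eq_0_iff)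
  qed
  \<comment> \<open>Left multiplication by \<open>A\<close> maps \<open>B\<close> injectively into
    itself, hence onto by dimension; so the inverse \<open>C\<close> of \<open>A\<close> lies in
    \<open>B\<close>.\<close>
  have lin: "linear ((**) A :: 'a cmat \<Rightarrow> 'a cmat)"
    by (intro bounded_linear.linear mm.bounded_linear_right)
  have "(**) A ` B = B"
  proof (rule subspace_dim_equal)
    have "inj ((**) A :: 'a cmat \<Rightarrow> 'a cmat)"
      using linear_injective_0[OF lin] inj by blast
    then show "dim B \<le> dim ((**) A ` B)"
      by (simp add: dim_image_eq[OF lin] inj_on_subset)
    show "subspace ((**) A ` B)" "subspace B"
      using linear_subspace_image[OF lin] subspace_star_algebra[OF B] by auto
    show "(**) A ` B \<subseteq> B"
      using A star_algebraD[OF B] by auto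
  qed
  then obtain C where C: "C \<in> B" "A ** C = mat 1"
    using star_algebraD(1)[OF B] by (metis imageE)
  then have CA: "C ** A = mat 1"
    by (simp add: matrix_left_right_inverse)
  have aC: "adj C ** A' = mat 1"
    using arg_cong[OF C(2), of adj] by (simp add: adj_mul A)
  have AA: "A + A' = sm 2 (mat 1)" "A' - A = sm (2 * \<i> * of_real s) H"
    by (simp_all add: A_def A'_def vec_eq_iff cmat_smult_def)
  have one: "mat 1 + A' ** C = sm 2 C"
    using arg_cong[OF AA(1), of "\<lambda>Z. Z ** C"] C by (simp add: cmat_simps)
  show thesis
  proof
    show "A' ** C \<in> unitaries B"
    proof -
      have "adj (A' ** C) ** (A' ** C) = adj C ** (A ** A') ** C"
        by (simp add: adj_mul A(4) matrix_mul_assoc)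
      also have "\<dots> = (adj C ** A') ** (A ** C)"
        by (subst A(5)) (simp add: matrix_mul_assoc)
      finally show ?thesis
        using A C star_algebraD[OF B] by (simp add: unitaries_def unitary_matI aC)
    qed
    show "A' ** C - mat 1 = sm (\<i> * of_real s) (H ** (mat 1 + A' ** C))"
      unfolding one using arg_cong[OF AA(2), of "\<lambda>Z. Z ** C"] C by (simp add: cmat_simps mult_ac)
  qed
qed

text \<open>Cayley transforms with \<open>s = 1 / (n + 1)\<close>. All unitaries have the same norm,
  so \<open>U n - 1\<close> is of order \<open>1 / n\<close>; its rescaling equals
  \<open>i H (1 + U n)\<close>, which tends to \<open>2 i H\<close>.\<close>

lemma unitaries_tangent:
  assumes B: "star_algebra B" and H: "H \<in> B" "adj H = H"
  obtains U :: "nat \<Rightarrow> 'd::finite cmat" where "\<And>n. U n \<in> unitaries B" "U \<longlonglongrightarrow> mat 1"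
    "(\<lambda>n. real (Suc n) *\<^sub>R (U n - mat 1)) \<longlonglongrightarrow> sm (2 * \<i>) H"
proof -
  have "\<exists>U. \<forall>n. U n \<in> unitaries B \<and> U n - mat 1 = sm (\<i> * of_real (1 / real (Suc n))) (H ** (mat 1 + U n))"
    using Cayley_transform[OF B H] by (intro choice) metis
  then obtain U where U: "\<And>n. U n \<in> unitaries B"
    "\<And>n. U n - mat 1 = sm (\<i> * of_real (1 / real (Suc n))) (H ** (mat 1 + U n))" by blast
  have "(\<lambda>n. U n - mat 1) \<longlonglongrightarrow> 0"
  proof (rule Lim_null_comparison)
    show "\<forall>\<^sub>F n in sequentially. norm (U n - mat 1) \<le> (norm H * (2 * norm (mat 1 :: 'd cmat))) * (1 / real (Suc n))"
    proof (rule always_eventually, rule allI)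
      fix n
      have "norm (H ** (mat 1 + U n)) \<le> norm H * (norm (mat 1 :: 'd cmat) + norm (U n))"
        using norm_cmat_mult[of H "mat 1 + U n"] norm_triangle_ineq[of "mat 1" "U n"]
        by (meson mult_left_mono norm_ge_zero order_trans)
      also have "norm (U n) = norm (mat 1 :: 'd cmat)"
        by (rule norm_unitary[OF unitariesD(3)[OF B U(1)]])
      finally have "norm (H ** (mat 1 + U n)) \<le> norm H * (2 * norm (mat 1 :: 'd cmat))" by simp
      then have "norm (H ** (mat 1 + U n)) * (1 / real (Suc n)) \<le> (norm H * (2 * norm (mat 1 :: 'd cmat))) * (1 / real (Suc n))"
        by (intro mult_right_mono) auto
      then show "norm (U n - mat 1) \<le> (norm H * (2 * norm (mat 1 :: 'd cmat))) * (1 / real (Suc n))"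
        by (subst U(2)) (simp add: norm_mult norm_divide mult_ac del: of_real_divide of_nat_Suc)
    qed
    show "(\<lambda>n. (norm H * (2 * norm (mat 1 :: 'd cmat))) * (1 / real (Suc n))) \<longlonglongrightarrow> 0"
      using LIMSEQ_inverse_real_of_nat by (intro tendsto_mult_right_zero) (simp add: divide_inverse)
  qed
  then have lim: "U \<longlonglongrightarrow> mat 1" by (simp add: LIM_zero_iff)
  have eq: "real (Suc n) *\<^sub>R (U n - mat 1) = sm \<i> (H ** (mat 1 + U n))" for n
    by (subst U(2)) (simp add: scaleR_eq_sm del: of_nat_Suc)
  have "(\<lambda>n. sm \<i> (H ** (mat 1 + U n))) \<longlonglongrightarrow> sm \<i> (H ** (mat 1 + mat 1))"
    by (intro sm.tendsto mm.tendsto tendsto_const tendsto_add lim)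
  also have "sm \<i> (H ** (mat 1 + mat 1)) = sm (2 * \<i>) H"
    by (simp only: mm.add_right matrix_mul_rid) (simp add: vec_eq_iff cmat_smult_def)
  finally have "(\<lambda>n. real (Suc n) *\<^sub>R (U n - mat 1)) \<longlonglongrightarrow> sm (2 * \<i>) H"
    by (simp only: eq)
  with U(1) lim that show thesis by blast
qed

lemma hermitian_decomposition:
  assumes "star_algebra B" "Y \<in> B"
  obtains H K where "H \<in> B" "K \<in> B" "adj H = H" "adj K = K" "Y = H + sm \<i> K"
proof
  show "sm (1/2) (Y + adj Y) \<in> B" "sm (-\<i>/2) (Y - adj Y) \<in> B"
    using assms by (simp_all add: star_algebraD)
  show "adj (sm (1/2) (Y + adj Y)) = sm (1/2) (Y + adj Y)"
    by (simp add: cmat_simps add.commute)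
  show "adj (sm (-\<i>/2) (Y - adj Y)) = sm (-\<i>/2) (Y - adj Y)"
    by (simp add: cmat_simps sm.minus_left)
  show "Y = sm (1/2) (Y + adj Y) + sm \<i> (sm (-\<i>/2) (Y - adj Y))"
    by (simp add: vec_eq_iff cmat_smult_def field_simps)
qed

text \<open>Stands in for the fact that the unitaries span \<open>B\<close>: \<open>L\<close> also
  kills limits of their rescaled differences, hence the Hermitian elements, which span
  \<open>B\<close> over the complex numbers.\<close>

lemma star_algebra_linear_induct:
  assumes B: "star_algebra (B :: 'd::finite cmat set)" and "Y \<in> B"
    and L: "bounded_linear L" and L': "\<And>c X. L (sm c X) = sm c (L X :: 'e::finite cmat)"
    and U: "\<And>U. U \<in> unitaries B \<Longrightarrow> L U = 0"
  shows "L Y = 0"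
proof -
  interpret L: bounded_linear L by (rule L)
  have herm: "L H = 0" if H: "H \<in> B" "adj H = H" for H
  proof -
    obtain V where V: "\<And>n. V n \<in> unitaries B"
      "(\<lambda>n. real (Suc n) *\<^sub>R (V n - mat 1)) \<longlonglongrightarrow> sm (2 * \<i>) H"
      by (rule unitaries_tangent[OF B H]) blast
    have "L (real (Suc n) *\<^sub>R (V n - mat 1)) = 0" for n
      using U[OF V(1)] U[OF unitariesD(1)[OF B]] by (simp add: L.diff L.scaleR)
    with L.tendsto[OF V(2)] have "(\<lambda>n. 0) \<longlonglongrightarrow> L (sm (2 * \<i>) H)" by simp
    then have "L (sm (2 * \<i>) H) = 0" by (simp add: LIMSEQ_const_iff)
    then have "sm (1 / (2 * \<i>)) (sm (2 * \<i>) (L H)) = 0" by (simp only: L' sm.zero_right)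
    then show ?thesis by simp
  qed
  obtain H K where "H \<in> B" "K \<in> B" "adj H = H" "adj K = K" "Y = H + sm \<i> K"
    using hermitian_decomposition[OF assms(1,2)] .
  then show ?thesis by (simp add: L.add L' herm sm.zero_right)
qed

lemma commute_unitaries:
  assumes "star_algebra B" "Y \<in> B" "\<And>U. U \<in> unitaries B \<Longrightarrow> X ** U = U ** X"
  shows "X ** Y = Y ** X"
proof -
  have "X ** Y - Y ** X = 0"
    by (rule star_algebra_linear_induct[OF assms(1,2), of "\<lambda>Y. X ** Y - Y ** X"])
      (simp_all add: assms(3) cmat_simps bounded_linear_sub mm.bounded_linear_left mm.bounded_linear_right)
  then show ?thesis by simp
qed

section \<open>The commutant\<close>

definition commutant :: "'d::finite cmat set \<Rightarrow> 'd cmat set" where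
  "commutant N = {X. \<forall>Y\<in>N. X ** Y = Y ** X}"

lemma star_algebra_commutant:
  assumes "star_algebra N"
  shows "star_algebra (commutant N)"
  unfolding star_algebra_def
proof (intro conjI ballI allI)
  show "mat 1 \<in> commutant N"
    by (simp add: commutant_def)
  fix X assume X: "X \<in> commutant N"
  have X': "X ** Y = Y ** X" if "Y \<in> N" for Y
    using X that unfolding commutant_def by blast
  show "adj X \<in> commutant N"
    unfolding commutant_def
  proof (intro CollectI ballI)
    fix Y assume "Y \<in> N"
    from arg_cong[OF X'[OF star_algebraD(4)[OF assms this]], of adj]
    show "adj X ** Y = Y ** adj X" by (simp add: adj_mul)
  qed
  show "sm c X \<in> commutant N" for c
    unfolding commutant_def by (intro CollectI ballI) (simp add: cmat_simps X')
  fix X2 assume X2: "X2 \<in> commutant N"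
  have X2': "X2 ** Y = Y ** X2" if "Y \<in> N" for Y
    using X2 that unfolding commutant_def by blast
  show "X + X2 \<in> commutant N"
    unfolding commutant_def by (intro CollectI ballI) (simp add: cmat_simps X' X2')
  show "X ** X2 \<in> commutant N"
    unfolding commutant_def
  proof (intro CollectI ballI)
    fix Y assume Y: "Y \<in> N"
    have "X ** X2 ** Y = X ** (Y ** X2)"
      by (simp add: X2'[OF Y] flip: matrix_mul_assoc)
    then show "X ** X2 ** Y = Y ** (X ** X2)"
      by (simp add: X'[OF Y] matrix_mul_assoc)
  qed
qed

section \<open>Averages of unitary conjugations\<close>

definition munit :: "'d::finite \<Rightarrow> 'd \<Rightarrow> 'd cmat" where
  "munit i j = (\<chi> a b. if a = i \<and> b = j then 1 else 0)"

lemma munit_expansion: "X = (\<Sum>i\<in>UNIV. \<Sum>j\<in>UNIV. sm (X $ i $ j) (munit i j))"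
proof -
  have "(\<Sum>i\<in>UNIV. \<Sum>j\<in>UNIV. X $ i $ j * (if a = i \<and> b = j then 1 else 0)) = X $ a $ b" for a b
  proof -
    have "(\<Sum>j\<in>UNIV. X $ i $ j * (if a = i \<and> b = j then 1 else 0)) = (if a = i then X $ i $ b else 0)" for i
      by (cases "a = i") (simp_all add: if_distrib cong: if_cong)
    then show ?thesis by simp
  qed
  then show ?thesis
    by (simp add: vec_eq_iff cmat_smult_def munit_def)
qed

lemma clinear_mapD:
  assumes "clinear_map T"
  shows "T (X + Y) = T X + T Y" "T (sm c X) = sm c (T X)" "linear T" "bounded_linear T"
proof -
  show 1: "T (X + Y) = T X + T Y" "T (sm c X) = sm c (T X)" for X Y c
    using assms by (simp_all add: clinear_map_def)
  show "linear T"
    by (rule linearI) (simp_all add: 1 scaleR_eq_sm)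
  then show "bounded_linear T"
    by (rule linear_conv_bounded_linear[THEN iffD1])
qed

lemma clinear_map_zero: "clinear_map T \<Longrightarrow> T 0 = 0"
  by (simp add: linear_0 clinear_mapD)

lemma clinear_map_sum: "clinear_map T \<Longrightarrow> T (\<Sum>i\<in>I. f i) = (\<Sum>i\<in>I. T (f i))"
  by (simp add: linear_sum clinear_mapD)

lemma clinear_map_diff: "clinear_map T \<Longrightarrow> T (X - Y) = T X - T Y"
  by (simp add: linear_diff clinear_mapD)

lemma clinear_map_scaleR: "clinear_map T \<Longrightarrow> T (r *\<^sub>R X) = r *\<^sub>R T X"
  by (simp add: linear_scale clinear_mapD)

lemma clinear_map_expansion:
  assumes "clinear_map T"
  shows "T X = (\<Sum>i\<in>UNIV. \<Sum>j\<in>UNIV. sm (X $ i $ j) (T (munit i j)))"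
  by (subst munit_expansion) (simp add: clinear_map_sum clinear_mapD assms)

lemma clinear_map_Ad: "clinear_map (Ad U)"
  by (simp add: clinear_map_def Ad_def cmat_simps)

text \<open>The Choi matrix, kept as a vector of blocks. It puts maps into a Euclidean space, where
  closest points, relative interiors and affine hulls make sense.\<close>

definition choi :: "('d::finite cmat \<Rightarrow> 'd cmat) \<Rightarrow> 'd cmat^'d^'d" where
  "choi T = (\<chi> i j. T (munit i j))"

lemma choi_inject:
  assumes "clinear_map S" "clinear_map T" "choi S = choi T"
  shows "S = T"
proof
  fix X
  have "S (munit i j) = T (munit i j)" for i j
    using assms(3) by (simp add: choi_def vec_eq_iff)
  then show "S X = T X"
    by (simp add: clinear_map_expansion[OF assms(1), of X] clinear_map_expansion[OF assms(2), of X])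
qed

lemma norm_vec_cong: "(\<And>i. norm (x $ i) = norm (y $ i)) \<Longrightarrow> norm x = norm y"
  by (simp add: norm_vec_def)

section \<open>Convex combinations of unitary conjugations\<close>

definition avg :: "nat \<Rightarrow> (nat \<Rightarrow> real) \<Rightarrow> (nat \<Rightarrow> 'd::finite cmat) \<Rightarrow> 'd cmat \<Rightarrow> 'd cmat" where
  "avg n w U X = (\<Sum>j<n. w j *\<^sub>R Ad (U j) X)"

definition unitary_weights :: "'d::finite cmat set \<Rightarrow> nat \<Rightarrow> (nat \<Rightarrow> real) \<Rightarrow> (nat \<Rightarrow> 'd cmat) \<Rightarrow> bool" where
  "unitary_weights B n w U \<longleftrightarrow> (\<forall>j<n. 0 \<le> w j \<and> U j \<in> unitaries B) \<and> (\<Sum>j<n. w j) = 1"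

definition Ad_hull :: "'d::finite cmat set \<Rightarrow> ('d cmat^'d^'d) set" where
  "Ad_hull B = convex hull ((\<lambda>U. choi (Ad U)) ` unitaries B)"

lemma mixed_unitary_avg: "unitary_weights B n w U \<Longrightarrow> mixed_unitary (avg n w U)"
  unfolding mixed_unitary_def unitary_weights_def unitaries_def avg_def by blast

lemma clinear_map_avg: "clinear_map (avg n w U)"
  unfolding clinear_map_def avg_def
  by (simp add: clinear_mapD[OF clinear_map_Ad] scaleR_add_right sum.distrib sm.sum_right sm_scaleR)

lemma choi_avg: "choi (avg n w U) = (\<Sum>j<n. w j *\<^sub>R choi (Ad (U j)))"
  by (simp add: choi_def avg_def vec_eq_iff)

lemma Ad_hull_iff: "x \<in> Ad_hull B \<longleftrightarrow> (\<exists>n w U. unitary_weights B n w U \<and> x = choi (avg n w U))"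
proof
  assume "x \<in> Ad_hull B"
  then obtain k u y where *: "\<And>i. i \<in> {1::nat..k} \<Longrightarrow> 0 \<le> u i \<and> y i \<in> (\<lambda>U. choi (Ad U)) ` unitaries B"
    "sum u {1..k} = 1" "(\<Sum>i=1..k. u i *\<^sub>R y i) = x"
    unfolding Ad_hull_def convex_hull_indexed by blast
  have "\<forall>i\<in>{1..k}. \<exists>U. U \<in> unitaries B \<and> y i = choi (Ad U)"
    using *(1) by blast
  then obtain U where U: "\<And>i. i \<in> {1..k} \<Longrightarrow> U i \<in> unitaries B \<and> y i = choi (Ad (U i))"
    by metis
  \<comment> \<open>\<open>convex_hull_indexed\<close> counts from 1, \<open>avg\<close> from
    0.\<close>
  have shift: "(\<Sum>i=1..k. f i) = (\<Sum>i<k. f (Suc i))" for f :: "nat \<Rightarrow> 'z::comm_monoid_add"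
    by (rule sum.reindex_bij_witness[of _ Suc "\<lambda>i. i - 1"]) auto
  have "unitary_weights B k (\<lambda>i. u (Suc i)) (\<lambda>i. U (Suc i))"
    unfolding unitary_weights_def using *(1,2) U shift[of u] by auto
  moreover have "x = choi (avg k (\<lambda>i. u (Suc i)) (\<lambda>i. U (Suc i)))"
    unfolding choi_avg *(3)[symmetric] shift[of "\<lambda>i. u i *\<^sub>R y i"]
    by (rule sum.cong) (use U in auto)
  ultimately show "\<exists>n w U. unitary_weights B n w U \<and> x = choi (avg n w U)" by blast
next
  assume "\<exists>n w U. unitary_weights B n w U \<and> x = choi (avg n w U)"
  then obtain n w U where *: "unitary_weights B n w U" "x = choi (avg n w U)" by blast
  show "x \<in> Ad_hull B"
    unfolding *(2) choi_avg
  proof (rule convex_sum)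
    show "convex (Ad_hull B)" by (simp add: Ad_hull_def)
    show "choi (Ad (U j)) \<in> Ad_hull B" if "j \<in> {..<n}" for j
      unfolding Ad_hull_def using *(1) that
      by (intro hull_inc) (auto simp: unitary_weights_def)
  qed (use *(1) in \<open>auto simp: unitary_weights_def\<close>)
qed

lemma compact_Ad_hull:
  assumes "star_algebra B"
  shows "compact (Ad_hull B)"
  unfolding Ad_hull_def choi_def Ad_def
  by (intro compact_convex_hull compact_continuous_image compact_unitaries assms continuous_on_vec_lambda
      mm.continuous_on continuous_on_id continuous_on_const linear_continuous_on[OF bounded_linear_adj])

section \<open>Averages invariant under the unitary group of an algebra\<close>

text \<open>Composition with \<open>Ad V\<close> on the left, in Choi coordinates; for unitary
  \<open>V\<close> this is a linear isometry.\<close>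

definition Ad_map :: "'d::finite cmat \<Rightarrow> 'd cmat^'d^'d \<Rightarrow> 'd cmat^'d^'d" where
  "Ad_map V z = (\<chi> i j. Ad V (z $ i $ j))"

lemma Ad_map_choi: "Ad_map V (choi T) = choi (\<lambda>X. Ad V (T X))"
  by (simp add: Ad_map_def choi_def)

lemma linear_Ad_map: "linear (Ad_map V)"
  by (rule linearI)
    (simp_all add: Ad_map_def vec_eq_iff clinear_mapD[OF clinear_map_Ad] clinear_map_scaleR[OF clinear_map_Ad])

lemma norm_Ad_map: "unitary_mat V \<Longrightarrow> norm (Ad_map V z) = norm z"
  by (rule norm_vec_cong, rule norm_vec_cong) (simp add: Ad_map_def norm_Ad)

text \<open>\<open>Ad V\<close> after \<open>Ad U\<close> is \<open>Ad (U ** V)\<close>, so right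
  translation by \<open>V\<close> permutes the generators of the hull.\<close>

lemma Ad_map_hull:
  assumes B: "star_algebra B" and V: "V \<in> unitaries B"
  shows "Ad_map V ` Ad_hull B = Ad_hull B"
proof -
  have "Ad_map V ` (\<lambda>U. choi (Ad U)) ` unitaries B = (\<lambda>U. choi (Ad U)) ` unitaries B"
  proof (rule equalityI; rule subsetI)
    fix x assume "x \<in> Ad_map V ` (\<lambda>U. choi (Ad U)) ` unitaries B"
    then obtain U where "U \<in> unitaries B" "x = choi (Ad (U ** V))"
      by (auto simp: Ad_map_choi Ad_comp)
    then show "x \<in> (\<lambda>U. choi (Ad U)) ` unitaries B"
      using unitariesD[OF B] V by blast
  next
    fix x assume "x \<in> (\<lambda>U. choi (Ad U)) ` unitaries B"
    then obtain U where U: "U \<in> unitaries B" "x = choi (Ad U)" by blast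
    then have "x = Ad_map V (choi (Ad (U ** adj V)))"
      by (simp add: Ad_map_choi Ad_comp unitary_matD[OF unitariesD(3)[OF B V]])
    moreover have "U ** adj V \<in> unitaries B"
      using unitariesD[OF B] V U by blast
    ultimately show "x \<in> Ad_map V ` (\<lambda>U. choi (Ad U)) ` unitaries B" by blast
  qed
  then show ?thesis
    unfolding Ad_hull_def by (simp add: convex_hull_linear_image[OF linear_Ad_map])
qed

text \<open>The point of least norm of the hull is unique, hence invariant; this replaces integration over Haar measure.\<close>

lemma left_invariant_avg:
  assumes B: "star_algebra B"
  obtains n w U where "unitary_weights B n w U"
    "\<And>V X. V \<in> unitaries B \<Longrightarrow> Ad V (avg n w U X) = avg n w U X"
proof -
  define e where "e = closest_point (Ad_hull B) 0"
  have conv: "convex (Ad_hull B)" by (simp add: Ad_hull_def)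
  have cl: "closed (Ad_hull B)" using compact_Ad_hull[OF B] by (rule compact_imp_closed)
  have ne: "Ad_hull B \<noteq> {}" using unitariesD(1)[OF B] by (auto simp: Ad_hull_def)
  have e: "e \<in> Ad_hull B" "\<And>z. z \<in> Ad_hull B \<Longrightarrow> norm e \<le> norm z"
    using closest_point_exists[OF cl ne, of 0] by (auto simp: e_def)
  obtain n w U where *: "unitary_weights B n w U" "e = choi (avg n w U)"
    using e(1) Ad_hull_iff by blast
  have "Ad V (avg n w U X) = avg n w U X" if V: "V \<in> unitaries B" for V X
  proof -
    have "Ad_map V e \<in> Ad_hull B"
      using e(1) Ad_map_hull[OF B V] by blast
    then have "Ad_map V e = closest_point (Ad_hull B) 0"
      using e(2) norm_Ad_map[OF unitariesD(3)[OF B V], of e]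
      by (intro closest_point_unique[OF conv cl]) auto
    then have "Ad_map V e = e" by (simp add: e_def)
    then have "choi (\<lambda>X. Ad V (avg n w U X)) = choi (avg n w U)"
      by (simp add: * Ad_map_choi)
    then have "(\<lambda>X. Ad V (avg n w U X)) = avg n w U"
      by (intro choi_inject clinear_map_avg)
        (simp_all add: clinear_map_def clinear_mapD[OF clinear_map_avg] clinear_mapD[OF clinear_map_Ad])
    then show ?thesis by metis
  qed
  with * that show thesis by blast
qed

lemma avg_fixed:
  assumes "unitary_weights B n w U" "\<And>j. j < n \<Longrightarrow> Ad (U j) X = X"
  shows "avg n w U X = X"
proof -
  have "avg n w U X = (\<Sum>j<n. w j) *\<^sub>R X"
    unfolding avg_def scaleR_sum_left using assms(2) by (intro sum.cong) auto
  then show ?thesis using assms(1) by (simp add: unitary_weights_def)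
qed

text \<open>Take \<open>E\<close> left invariant and let \<open>F\<close> be its adjoint for the
  trace pairing; by duality \<open>F\<close> is right invariant. Then \<open>F E = E\<close>,
  because the conjugations in \<open>F\<close> fix the values of \<open>E\<close>, and
  \<open>F E = F\<close>, because \<open>F\<close> absorbs the conjugations in \<open>E\<close>. So
  \<open>E = F\<close> is invariant on both sides.\<close>

lemma invariant_avg:
  assumes B: "star_algebra B"
  obtains n w U where "unitary_weights B n w U"
    "\<And>V X. V \<in> unitaries B \<Longrightarrow> Ad V (avg n w U X) = avg n w U X"
    "\<And>V X. V \<in> unitaries B \<Longrightarrow> avg n w U (Ad V X) = avg n w U X"
proof -
  obtain n w U where U: "unitary_weights B n w U"
    "\<And>V X. V \<in> unitaries B \<Longrightarrow> Ad V (avg n w U X) = avg n w U X"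
    using left_invariant_avg[OF B] by metis
  define E F where "E = avg n w U" and "F = avg n w (\<lambda>j. adj (U j))"
  have FE: "F (E X) = E X" for X
    unfolding F_def
  proof (rule avg_fixed)
    show "unitary_weights B n w (\<lambda>j. adj (U j))"
      using U(1) unitariesD[OF B] by (auto simp: unitary_weights_def)
    show "Ad (adj (U j)) (E X) = E X" if "j < n" for j
      unfolding E_def using U(1) that unitariesD[OF B] by (intro U(2)) (auto simp: unitary_weights_def)
  qed
  have dual: "trace (Y ** F X) = trace (E Y ** X)" for X Y
  proof -
    have "trace (Y ** Ad (adj V) X) = trace (Ad V Y ** X)" for V
      using trace_mul_sym[of "Y ** V ** X" "adj V"]
      by (simp add: Ad_def matrix_mul_assoc) 
    then show ?thesis
      unfolding F_def E_def avg_def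
      by (simp add: cmat_simps trace_sum scaleR_eq_sm trace_sm)
  qed
  have FV: "F (Ad V X) = F X" if V: "V \<in> unitaries B" for V X
  proof (rule cmat_eqI_trace)
    fix Y
    have "trace (Y ** F (Ad V X)) = trace (Ad (adj V) (E Y) ** X)"
      unfolding dual using trace_mul_sym[of "E Y ** adj V ** X" V]
      by (simp add: Ad_def matrix_mul_assoc)
    also have "Ad (adj V) (E Y) = E Y"
      unfolding E_def using V unitariesD[OF B] by (intro U(2)) auto
    finally show "trace (Y ** F (Ad V X)) = trace (Y ** F X)" by (simp add: dual)
  qed
  have "F (E X) = F X" for X
  proof -
    have "clinear_map F" by (simp add: F_def clinear_map_avg)
    then have "F (E X) = (\<Sum>j<n. w j *\<^sub>R F (Ad (U j) X))"
      by (simp add: E_def avg_def clinear_map_sum clinear_map_scaleR)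
    also have "\<dots> = (\<Sum>j<n. w j) *\<^sub>R F X"
      unfolding scaleR_sum_left using FV U(1) by (intro sum.cong) (auto simp: unitary_weights_def)
    finally show ?thesis using U(1) by (simp add: unitary_weights_def)
  qed
  with FE have "F = E" by (simp add: fun_eq_iff)
  with FV have "avg n w U (Ad V X) = avg n w U X" if "V \<in> unitaries B" for V X
    using that by (simp add: E_def)
  with U that show thesis by blast
qed

text \<open>\<open>E\<close> is an average of the points \<open>Ad\<^sub>V c\<close> for any \<open>c\<close> in the relative interior, since \<open>E c = E\<close>.\<close>

lemma avg_in_rel_interior:
  assumes B: "star_algebra B" and U: "unitary_weights B n w U"
    and inv: "\<And>V X. V \<in> unitaries B \<Longrightarrow> avg n w U (Ad V X) = avg n w U X"
  shows "choi (avg n w U) \<in> rel_interior (Ad_hull B)"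
proof -
  have conv: "convex (Ad_hull B)" by (simp add: Ad_hull_def)
  have "Ad_hull B \<noteq> {}" using unitariesD(1)[OF B] by (auto simp: Ad_hull_def)
  then obtain c where c: "c \<in> rel_interior (Ad_hull B)"
    using rel_interior_eq_empty[OF conv] by blast
  then obtain m v W where W: "unitary_weights B m v W" "c = choi (avg m v W)"
    using rel_interior_subset Ad_hull_iff by blast
  \<comment> \<open>\<open>Ad_map V\<close> maps the hull bijectively onto itself and so preserves
    its relative interior.\<close>
  have ri: "Ad_map V c \<in> rel_interior (Ad_hull B)" if V: "V \<in> unitaries B" for V
  proof -
    have "inj (Ad_map V)"
      using linear_injective_0[OF linear_Ad_map] norm_Ad_map[OF unitariesD(3)[OF B V]]
      by (metis norm_eq_zero)
    then have "rel_interior (Ad_map V ` Ad_hull B) = Ad_map V ` rel_interior (Ad_hull B)"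
      using linear_Ad_map by (intro rel_interior_injective_linear_image)
        (simp_all add: linear_conv_bounded_linear)
    with c Ad_map_hull[OF B V] show ?thesis by auto
  qed
  have "(\<Sum>j<n. w j *\<^sub>R Ad_map (U j) c) \<in> rel_interior (Ad_hull B)"
    using U ri by (intro convex_sum convex_rel_interior conv) (auto simp: unitary_weights_def)
  also have "(\<Sum>j<n. w j *\<^sub>R Ad_map (U j) c) = choi (\<lambda>X. avg n w U (avg m v W X))"
    by (simp add: W(2) choi_def Ad_map_def avg_def[of n] vec_eq_iff)
  also have "(\<lambda>X. avg n w U (avg m v W X)) = avg n w U"
  proof
    fix X
    have "avg n w U (avg m v W X) = (\<Sum>j<m. v j *\<^sub>R avg n w U (Ad (W j) X))"
      by (simp add: avg_def[of m] clinear_map_sum[OF clinear_map_avg] clinear_map_scaleR[OF clinear_map_avg])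
    also have "\<dots> = (\<Sum>j<m. v j) *\<^sub>R avg n w U X"
      unfolding scaleR_sum_left using inv W(1) by (intro sum.cong) (auto simp: unitary_weights_def)
    finally show "avg n w U (avg m v W X) = avg n w U X"
      using W(1) by (simp add: unitary_weights_def)
  qed
  finally show ?thesis .
qed

section \<open>The affine hull of the unitary conjugations\<close>

text \<open>The space \<open>D\<close> of the introduction: the complexified direction space of the
  affine hull. Its elements are maps rather than Choi matrices, so that they can be
  composed.\<close>

inductive_set Ad_span :: "'d::finite cmat set \<Rightarrow> ('d cmat \<Rightarrow> 'd cmat) set" for B where
  diff: "U \<in> unitaries B \<Longrightarrow> V \<in> unitaries B \<Longrightarrow> (\<lambda>X. Ad U X - Ad V X) \<in> Ad_span B"
| add: "S \<in> Ad_span B \<Longrightarrow> T \<in> Ad_span B \<Longrightarrow> (\<lambda>X. S X + T X) \<in> Ad_span B"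
| scale: "T \<in> Ad_span B \<Longrightarrow> (\<lambda>X. sm c (T X)) \<in> Ad_span B"

lemma clinear_map_Ad_span: "T \<in> Ad_span B \<Longrightarrow> clinear_map T"
  by (induction rule: Ad_span.induct)
    (simp_all add: clinear_map_def clinear_mapD[OF clinear_map_Ad] cmat_simps mult.commute)

lemma Ad_span_diff: "S \<in> Ad_span B \<Longrightarrow> T \<in> Ad_span B \<Longrightarrow> (\<lambda>X. S X - T X) \<in> Ad_span B"
  using Ad_span.add[of S B "\<lambda>X. sm (-1) (T X)"] Ad_span.scale[of T B "-1"] by (simp add: sm_minus_one)

lemma Ad_span_scaleR: "T \<in> Ad_span B \<Longrightarrow> (\<lambda>X. r *\<^sub>R T X) \<in> Ad_span B"
  unfolding scaleR_eq_sm by (rule Ad_span.scale)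

lemma Ad_span_zero: "star_algebra B \<Longrightarrow> (\<lambda>X. 0) \<in> Ad_span B"
  using Ad_span.diff[OF unitariesD(1)[of B] unitariesD(1)[of B]] by simp

lemma Ad_span_sum:
  assumes "star_algebra B" "\<And>i. i \<in> I \<Longrightarrow> f i \<in> Ad_span B"
  shows "(\<lambda>X. \<Sum>i\<in>I. f i X) \<in> Ad_span B"
  using assms(2)
proof (induction I rule: infinite_finite_induct)
  case (insert i I)
  then show ?case
    using Ad_span.add[of "f i" B "\<lambda>X. \<Sum>i\<in>I. f i X"] by simp
qed (simp_all add: Ad_span_zero[OF assms(1)])

text \<open>\<open>Ad W\<close> after \<open>Ad U - Ad V\<close> is
  \<open>Ad (U ** W) - Ad (V ** W)\<close>, so \<open>D\<close> is stable under \<open>Ad W\<close>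
  on the left, and hence under the linear combinations of such maps that make up
  \<open>D\<close>.\<close>

lemma Ad_span_comp:
  assumes B: "star_algebra B" and S: "S \<in> Ad_span B" and T: "T \<in> Ad_span B"
  shows "(\<lambda>X. S (T X)) \<in> Ad_span B"
proof -
  have Ad: "(\<lambda>X. Ad W (T X)) \<in> Ad_span B" if W: "W \<in> unitaries B" for W
    using T
  proof (induction rule: Ad_span.induct)
    case (diff U V)
    then have "(\<lambda>X. Ad (U ** W) X - Ad (V ** W) X) \<in> Ad_span B"
      using W unitariesD(4)[OF B] by (intro Ad_span.diff) auto
    then show ?case by (simp add: clinear_map_diff[OF clinear_map_Ad] Ad_comp)
  next
    case (add S T)
    then show ?case using Ad_span.add by (simp add: clinear_mapD[OF clinear_map_Ad])
  next
    case (scale T c)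
    then show ?case using Ad_span.scale by (simp add: clinear_mapD[OF clinear_map_Ad])
  qed
  from S show ?thesis
  proof (induction rule: Ad_span.induct)
    case (diff U V)
    then show ?case using Ad_span_diff Ad by blast
  next
    case (add S T)
    then show ?case using Ad_span.add by blast
  next
    case (scale T c)
    then show ?case using Ad_span.scale by blast
  qed
qed

text \<open>In Choi coordinates \<open>D\<close> is a subspace of a finite-dimensional space.
  Closedness lets limits of difference quotients stay in \<open>D\<close>.\<close>

lemma closed_choi_Ad_span:
  assumes "star_algebra B"
  shows "closed (choi ` Ad_span B)"
proof (rule closed_subspace, rule subspaceI)
  show "0 \<in> choi ` Ad_span B"
    by (rule image_eqI[OF _ Ad_span_zero[OF assms]]) (simp add: choi_def vec_eq_iff)
next
  fix x y assume "x \<in> choi ` Ad_span B" "y \<in> choi ` Ad_span B"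
  then obtain S T where "x = choi S" "y = choi T" "S \<in> Ad_span B" "T \<in> Ad_span B" by blast
  moreover from this have "x + y = choi (\<lambda>X. S X + T X)"
    by (simp add: choi_def vec_eq_iff)
  ultimately show "x + y \<in> choi ` Ad_span B"
    using Ad_span.add by blast
next
  fix r x assume "x \<in> choi ` Ad_span B"
  then obtain T where "x = choi T" "T \<in> Ad_span B" by blast
  moreover from this have "r *\<^sub>R x = choi (\<lambda>X. r *\<^sub>R T X)"
    by (simp add: choi_def vec_eq_iff)
  ultimately show "r *\<^sub>R x \<in> choi ` Ad_span B"
    using Ad_span_scaleR by blast
qed

section \<open>Commutator maps and their products\<close>

text \<open>For Hermitian \<open>H\<close>, differentiate \<open>Ad U\<close> at the identity along
  unitaries with tangent \<open>2 i H\<close>: the derivative is \<open>- 2 i\<close> times the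
  commutator with \<open>H\<close>. The factor is removed because \<open>D\<close> is complex, and
  \<open>Y = H + i K\<close> gives the general case.\<close>

lemma commutator_mem_Ad_span:
  assumes B: "star_algebra B" and Y: "Y \<in> B"
  shows "(\<lambda>X. Y ** X - X ** Y) \<in> Ad_span B"
proof -
  have herm: "(\<lambda>X. H ** X - X ** H) \<in> Ad_span B" if H: "H \<in> B" "adj H = H" for H
  proof -
    obtain U where U: "\<And>n. U n \<in> unitaries B" "U \<longlonglongrightarrow> mat 1"
      "(\<lambda>n. real (Suc n) *\<^sub>R (U n - mat 1)) \<longlonglongrightarrow> sm (2 * \<i>) H"
      by (rule unitaries_tangent[OF B H]) blast
    define g where "g n X = real (Suc n) *\<^sub>R (Ad (U n) X - Ad (mat 1) X)" for n X
    define h where "h X = sm (- 2 * \<i>) (H ** X - X ** H)" for X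
    have gh: "(\<lambda>n. g n X) \<longlonglongrightarrow> h X" for X
    proof -
      define \<Delta> where "\<Delta> n = real (Suc n) *\<^sub>R (U n - mat 1)" for n
      \<comment> \<open>Unitarity gives \<open>Ad U X - X = adj U (X U - U X)\<close>, and inside
        the commutator \<open>U\<close> may be replaced by \<open>U - 1\<close>.\<close>
      have "g n X = adj (U n) ** (X ** \<Delta> n - \<Delta> n ** X)" for n
        using unitary_matD(1)[OF unitariesD(3)[OF B U(1)], of n]
        by (simp add: g_def \<Delta>_def Ad_def cmat_simps scaleR_diff_right)
      moreover have "(\<lambda>n. adj (U n) ** (X ** \<Delta> n - \<Delta> n ** X)) \<longlonglongrightarrow>
          adj (mat 1) ** (X ** sm (2 * \<i>) H - sm (2 * \<i>) H ** X)"
        unfolding \<Delta>_def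
        by (intro mm.tendsto tendsto_diff tendsto_const U bounded_linear.tendsto[OF bounded_linear_adj])
      moreover have "adj (mat 1) ** (X ** sm (2 * \<i>) H - sm (2 * \<i>) H ** X) = h X"
        by (simp add: h_def cmat_simps sm.minus_left)
      ultimately show ?thesis by simp
    qed
    have "(\<lambda>n. choi (g n)) \<longlonglongrightarrow> choi h"
      unfolding choi_def by (intro tendsto_vec_lambda gh)
    moreover have "choi (g n) \<in> choi ` Ad_span B" for n
      unfolding g_def[abs_def]
      by (rule imageI, rule Ad_span_scaleR[OF Ad_span.diff[OF U(1) unitariesD(1)[OF B]]])
    ultimately have "choi h \<in> choi ` Ad_span B"
      by - (rule closed_sequentially[OF closed_choi_Ad_span[OF B], of "\<lambda>n. choi (g n)"])
    then obtain T where T: "T \<in> Ad_span B" "choi h = choi T" by blast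
    have "clinear_map h"
      by (simp add: clinear_map_def h_def cmat_simps mult.commute)
    then have "h = T"
      using clinear_map_Ad_span[OF T(1)] T(2) by (rule choi_inject)
    then have "(\<lambda>X. sm (\<i> / 2) (h X)) \<in> Ad_span B"
      using Ad_span.scale[OF T(1)] by simp
    then show ?thesis by (simp add: h_def)
  qed
  obtain H K where HK: "H \<in> B" "K \<in> B" "adj H = H" "adj K = K" "Y = H + sm \<i> K"
    using hermitian_decomposition[OF B Y] .
  have "(\<lambda>X. Y ** X - X ** Y) = (\<lambda>X. (H ** X - X ** H) + sm \<i> (K ** X - X ** K))"
    by (simp add: HK(5) cmat_simps fun_eq_iff)
  then show ?thesis
    using Ad_span.add[OF herm Ad_span.scale[OF herm]] HK by simp
qed

text \<open>With \<open>ad\<^sub>W X = W X - X W\<close> and \<open>L\<^sub>Z\<close> the left multiplication by \<open>Z\<close>, the reason is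
  \<open>2 ad\<^sub>W L\<^sub>Z ad\<^sub>W = ad\<^sub>W ad\<^sub>Z ad\<^sub>W + ad\<^sub>W ad\<^bsub>WZ+ZW\<^esub> - ad\<^bsub>WW\<^esub> ad\<^sub>Z\<close>.\<close>

lemma double_commutator_mem_Ad_span:
  assumes B: "star_algebra B" and WZ: "W \<in> B" "Z \<in> B"
  shows "(\<lambda>X. W ** Z ** (W ** X - X ** W) - Z ** (W ** X - X ** W) ** W) \<in> Ad_span B"
proof -
  define ad where "ad Y X = Y ** X - X ** Y" for Y X :: "'a cmat"
  define T where "T X = ad W (ad Z (ad W X)) + ad W (ad (W ** Z + Z ** W) X) - ad (W ** W) (ad Z X)" for X
  have ad: "ad Y \<in> Ad_span B" if "Y \<in> B" for Y
    unfolding ad_def[abs_def] using commutator_mem_Ad_span[OF B that] .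
  have "(\<lambda>X. sm (1/2) (T X)) \<in> Ad_span B"
    unfolding T_def
    by (rule Ad_span.scale[OF Ad_span_diff[OF Ad_span.add[OF
            Ad_span_comp[OF B ad Ad_span_comp[OF B ad ad]] Ad_span_comp[OF B ad ad]] Ad_span_comp[OF B ad ad]]])
      (intro star_algebraD[OF B] WZ)+
  moreover have "sm (1/2) (T X) = W ** Z ** (W ** X - X ** W) - Z ** (W ** X - X ** W) ** W" (is "_ = ?R") for X
  proof -
    have "T X = ?R + ?R"
      by (simp add: T_def ad_def cmat_simps algebra_simps)
    also have "\<dots> = sm 2 ?R" by (simp add: vec_eq_iff cmat_smult_def)
    finally show ?thesis by simp
  qed
  ultimately show ?thesis by simp
qed

text \<open>The preceding expression is quadratic in \<open>W\<close>; this is its polarization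
  \<open>Q (W + V) - Q W - Q V\<close>.\<close>

lemma double_commutator_polarized:
  assumes B: "star_algebra B" and WZV: "W \<in> B" "Z \<in> B" "V \<in> B"
  shows "(\<lambda>X. W ** Z ** V ** X + V ** Z ** W ** X - W ** Z ** X ** V - V ** Z ** X ** W
    - Z ** V ** X ** W - Z ** W ** X ** V + Z ** X ** V ** W + Z ** X ** W ** V) \<in> Ad_span B"
proof -
  define Q where "Q W X = W ** Z ** (W ** X - X ** W) - Z ** (W ** X - X ** W) ** W" for W X :: "'a cmat"
  have Q: "Q W \<in> Ad_span B" if "W \<in> B" for W
    unfolding Q_def[abs_def] by (rule double_commutator_mem_Ad_span[OF B that WZV(2)])
  have "(\<lambda>X. Q (W + V) X - Q W X - Q V X) \<in> Ad_span B"
    by (intro Ad_span_diff[OF Ad_span_diff[OF Q Q] Q] WZV star_algebraD[OF B])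
  then show ?thesis
    by (rule back_subst[of "\<lambda>f. f \<in> Ad_span B"]) (simp add: Q_def fun_eq_iff cmat_simps algebra_simps)
qed

section \<open>Two-sided multiplications modulo the span\<close>

text \<open>Being fixed by \<open>Ad V\<close> means commuting with \<open>V\<close>, and the
  unitaries determine \<open>B\<close> linearly.\<close>

lemma avg_commutes:
  assumes B: "star_algebra B" and Y: "Y \<in> B"
    and left: "\<And>V X. V \<in> unitaries B \<Longrightarrow> Ad V (avg n w U X) = avg n w U X"
  shows "avg n w U X ** Y = Y ** avg n w U X"
proof (rule commute_unitaries[OF B Y])
  fix V assume V: "V \<in> unitaries B"
  have "V ** avg n w U X = V ** Ad V (avg n w U X)" using left[OF V] by simp
  then show "avg n w U X ** V = V ** avg n w U X"
    using unitary_matD[OF unitariesD(3)[OF B V]] by (simp add: Ad_def matrix_mul_assoc)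
qed

text \<open>\<open>Ad V (V ** X) = X ** V\<close>, so right invariance is the claim for unitary
  \<open>Y\<close>; both sides are linear in \<open>Y\<close>.\<close>

lemma avg_tracial:
  assumes B: "star_algebra B" and Y: "Y \<in> B"
    and right: "\<And>V X. V \<in> unitaries B \<Longrightarrow> avg n w U (Ad V X) = avg n w U X"
  shows "avg n w U (Y ** X) = avg n w U (X ** Y)"
proof -
  define E where "E = avg n w U"
  have clE: "clinear_map E" by (simp add: E_def clinear_map_avg)
  have "E (Y ** X - X ** Y) = 0"
  proof (rule star_algebra_linear_induct[OF B Y, of "\<lambda>Y. E (Y ** X - X ** Y)"])
    show "bounded_linear (\<lambda>Y. E (Y ** X - X ** Y))"
      by (intro bounded_linear_compose[OF clinear_mapD(4)[OF clE]] bounded_linear_sub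
          mm.bounded_linear_left mm.bounded_linear_right)
    show "E (sm c Y ** X - X ** sm c Y) = sm c (E (Y ** X - X ** Y))" for c Y
      by (simp add: cmat_simps clinear_mapD[OF clE] clinear_map_diff[OF clE])
    show "E (V ** X - X ** V) = 0" if V: "V \<in> unitaries B" for V
      using right[OF V, of "V ** X"] unitary_matD[OF unitariesD(3)[OF B V]]
      by (simp add: E_def[symmetric] Ad_def matrix_mul_assoc clinear_map_diff[OF clE])
  qed
  then show ?thesis by (simp add: E_def clinear_map_diff[OF clinear_map_avg])
qed

text \<open>The congruence of the introduction. Averaging the polarized identity over the
  \<open>U j\<close> gives it up to terms in \<open>E z\<close>; as \<open>E z\<close> commutes with
  \<open>B\<close>, these are removed by the same identity for \<open>E z\<close>.\<close>

lemma sandwich_mem_Ad_span: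
  assumes B: "star_algebra B" and U: "unitary_weights B n w U"
    and left: "\<And>V X. V \<in> unitaries B \<Longrightarrow> Ad V (avg n w U X) = avg n w U X"
    and right: "\<And>V X. V \<in> unitaries B \<Longrightarrow> avg n w U (Ad V X) = avg n w U X"
    and zy: "z \<in> B" "y \<in> B"
  shows "(\<lambda>X. z ** y ** X - z ** X ** y + avg n w U (X ** (y ** z - z ** y))) \<in> Ad_span B"
proof -
  define E where "E = avg n w U"
  have clE: "clinear_map E" by (simp add: E_def clinear_map_avg)
  have Uj: "U j \<in> unitaries B" "U j \<in> B" "adj (U j) \<in> B" "unitary_mat (U j)" "0 \<le> w j" if "j < n" for j
    using U that unitariesD[OF B] star_algebraD[OF B] by (auto simp: unitary_weights_def)
  have comm: "E X ** Y = Y ** E X" if "Y \<in> B" for X Y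
    unfolding E_def by (rule avg_commutes[OF B that left])
  have tr: "E (Y ** X) = E (X ** Y)" if "Y \<in> B" for X Y
    unfolding E_def by (rule avg_tracial[OF B that right])
  have EB: "E Y \<in> B" if "Y \<in> B" for Y
    unfolding E_def avg_def Ad_def using that Uj star_algebraD[OF B] by (intro star_algebra_sum[OF B]) auto
  have EE: "E (E X) = E X" for X
    unfolding E_def by (rule avg_fixed[OF U]) (rule left[OF Uj(1)])
  have w: "(\<Sum>j<n. w j *\<^sub>R X) = X" for X :: "'a cmat"
    using U by (simp add: unitary_weights_def flip: scaleR_sum_left)
  have E_sum: "(\<Sum>j<n. w j *\<^sub>R (P ** adj (U j) ** X ** U j ** R)) = P ** E X ** R" for P R X :: "'a cmat"
    by (simp add: E_def avg_def Ad_def cmat_simps)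
  have key: "(\<lambda>X. y ** E z ** X + z ** y ** X - z ** X ** y - E z ** X ** y
      + E (X ** (y ** z - z ** y))) \<in> Ad_span B" if zy: "z \<in> B" "y \<in> B" for z y
  proof -
    \<comment> \<open>\<open>double_commutator_polarized\<close> with \<open>W = y\<close>,
      \<open>Z = adj (U j)\<close>, \<open>V = z ** U j\<close>: in every word either
      \<open>U j ** adj (U j)\<close> cancels, or \<open>adj (U j)\<close> stands to the left of
      \<open>U j\<close> and the average produces \<open>E\<close>.\<close>
    define q where "q j X = y ** adj (U j) ** (z ** U j) ** X + (z ** U j) ** adj (U j) ** y ** X
      - y ** adj (U j) ** X ** (z ** U j) - (z ** U j) ** adj (U j) ** X ** y
      - adj (U j) ** (z ** U j) ** X ** y - adj (U j) ** y ** X ** (z ** U j)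
      + adj (U j) ** X ** (z ** U j) ** y + adj (U j) ** X ** y ** (z ** U j)" for j X
    have "(\<lambda>X. \<Sum>j<n. w j *\<^sub>R q j X) \<in> Ad_span B"
    proof (intro Ad_span_sum B Ad_span_scaleR)
      fix j assume "j \<in> {..<n}"
      then show "q j \<in> Ad_span B"
        unfolding q_def[abs_def]
        by (intro double_commutator_polarized B zy Uj star_algebraD[OF B]) auto
    qed
    moreover have "(\<Sum>j<n. w j *\<^sub>R q j X) = y ** E z ** X + z ** y ** X - z ** X ** y - E z ** X ** y
      + E (X ** (y ** z - z ** y))" for X
    proof -
      have 1: "(\<Sum>j<n. w j *\<^sub>R ((z ** U j) ** adj (U j) ** R)) = z ** R" for R :: "'a cmat"
      proof -
        have "(\<Sum>j<n. w j *\<^sub>R ((z ** U j) ** adj (U j) ** R)) = (\<Sum>j<n. w j *\<^sub>R (z ** R))"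
          by (intro sum.cong) (auto simp: unitary_matD Uj)
        then show ?thesis by (simp add: w)
      qed
      have "(\<Sum>j<n. w j *\<^sub>R q j X) = y ** E z ** X + z ** (y ** X) - y ** E (X ** z) ** mat 1 - z ** (X ** y)
        - mat 1 ** E z ** (X ** y) - mat 1 ** E (y ** X ** z) ** mat 1
        + mat 1 ** E (X ** z) ** y + mat 1 ** E (X ** y ** z) ** mat 1"
      proof -
        have q: "q j X = y ** adj (U j) ** z ** U j ** X + z ** U j ** adj (U j) ** (y ** X)
            - y ** adj (U j) ** (X ** z) ** U j ** mat 1 - z ** U j ** adj (U j) ** (X ** y)
            - mat 1 ** adj (U j) ** z ** U j ** (X ** y) - mat 1 ** adj (U j) ** (y ** X ** z) ** U j ** mat 1
            + mat 1 ** adj (U j) ** (X ** z) ** U j ** y + mat 1 ** adj (U j) ** (X ** y ** z) ** U j ** mat 1" for j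
          by (simp add: q_def matrix_mul_assoc)
        show ?thesis
          unfolding q scaleR_diff_right scaleR_add_right sum.distrib sum_subtractf E_sum 1 ..
      qed
      \<comment> \<open>The two terms in \<open>E (X ** z)\<close> cancel, since this matrix
        commutes with \<open>y\<close>.\<close>
      also have "\<dots> = y ** E z ** X + z ** y ** X - z ** X ** y - E z ** X ** y
          - E (y ** (X ** z)) + E (X ** y ** z)"
        using comm[OF zy(2), of "X ** z"] by (simp add: matrix_mul_assoc)
      also have "\<dots> = y ** E z ** X + z ** y ** X - z ** X ** y - E z ** X ** y
          + E (X ** (y ** z - z ** y))"
        unfolding tr[OF zy(2)] by (simp add: cmat_simps clinear_map_diff[OF clE])
      finally show ?thesis .
    qed
    ultimately show ?thesis by simp
  qed
  \<comment> \<open>\<open>key\<close> for \<open>E z\<close>, halved. As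
    \<open>E (E z) = E z\<close> commutes with \<open>y\<close>, this is exactly the surplus
    \<open>y ** E z ** X - E z ** X ** y\<close> in \<open>key\<close> for \<open>z\<close>.\<close>
  have central: "(\<lambda>X. sm (1/2) (y ** E (E z) ** X + E z ** y ** X - E z ** X ** y - E (E z) ** X ** y
      + E (X ** (y ** E z - E z ** y)))) \<in> Ad_span B"
    by (rule Ad_span.scale[OF key[OF EB[OF zy(1)] zy(2)]])
  have "(\<lambda>X. (y ** E z ** X + z ** y ** X - z ** X ** y - E z ** X ** y + E (X ** (y ** z - z ** y)))
      - sm (1/2) (y ** E (E z) ** X + E z ** y ** X - E z ** X ** y - E (E z) ** X ** y
        + E (X ** (y ** E z - E z ** y)))) \<in> Ad_span B"
    by (rule Ad_span_diff[OF key[OF zy] central])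
  moreover have "sm (1/2) (y ** E (E z) ** X + E z ** y ** X - E z ** X ** y - E (E z) ** X ** y
        + E (X ** (y ** E z - E z ** y))) = y ** E z ** X - E z ** X ** y" for X
    using comm[OF zy(2), of z]
    by (simp add: EE mm.zero_right clinear_map_zero[OF clE]) (simp add: vec_eq_iff cmat_smult_def)
  ultimately show ?thesis
    by (simp add: E_def algebra_simps)
qed

text \<open>Summed over \<open>k\<close>, the sandwich relation puts \<open>id - T\<close> into
  \<open>D\<close>: the two sum conditions turn the first term into \<open>X\<close> and make the
  argument of the average vanish. \<open>D\<close> is complex while the affine hull is real; since
  \<open>T\<close> respects adjoints, only the real parts of the coefficients matter.\<close>

lemma sandwich_sum_in_affine_hull:
  assumes B: "star_algebra B"
    and ab: "\<And>k. k \<in> K \<Longrightarrow> a k \<in> B \<and> b k \<in> B"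
    and T: "\<And>X. T X = (\<Sum>k\<in>K. a k ** X ** b k)"
    and unital: "(\<Sum>k\<in>K. a k ** b k) = mat 1" and tp: "(\<Sum>k\<in>K. b k ** a k) = mat 1"
    and herm: "\<And>X. T (adj X) = adj (T X)"
  shows "choi T \<in> affine hull (Ad_hull B)"
proof -
  obtain n w U where U: "unitary_weights B n w U"
    "\<And>V X. V \<in> unitaries B \<Longrightarrow> Ad V (avg n w U X) = avg n w U X"
    "\<And>V X. V \<in> unitaries B \<Longrightarrow> avg n w U (Ad V X) = avg n w U X"
    using invariant_avg[OF B] by metis
  define \<Delta> where "\<Delta> X = X - T X" for X
  have "(\<lambda>X. \<Sum>k\<in>K. a k ** b k ** X - a k ** X ** b k + avg n w U (X ** (b k ** a k - a k ** b k))) \<in> Ad_span B"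
    using ab by (intro Ad_span_sum[OF B] sandwich_mem_Ad_span[OF B U]) auto
  also have "(\<lambda>X. \<Sum>k\<in>K. a k ** b k ** X - a k ** X ** b k + avg n w U (X ** (b k ** a k - a k ** b k))) = \<Delta>"
  proof
    fix X
    have "(\<Sum>k\<in>K. a k ** b k ** X - a k ** X ** b k + avg n w U (X ** (b k ** a k - a k ** b k)))
      = (\<Sum>k\<in>K. a k ** b k) ** X - T X
        + avg n w U (X ** ((\<Sum>k\<in>K. b k ** a k) - (\<Sum>k\<in>K. a k ** b k)))"
      by (simp add: T sum.distrib sum_subtractf mm.sum_left mm.sum_right mm.diff_right clinear_map_sum[OF clinear_map_avg]
          clinear_map_diff[OF clinear_map_avg])
    then show "(\<Sum>k\<in>K. a k ** b k ** X - a k ** X ** b k + avg n w U (X ** (b k ** a k - a k ** b k))) = \<Delta> X"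
      by (simp add: unital tp \<Delta>_def mm.zero_right clinear_map_zero[OF clinear_map_avg])
  qed
  finally have \<Delta>: "\<Delta> \<in> Ad_span B" .
  define S where "S = (\<lambda>U. choi (Ad U)) ` unitaries B"
  define one where "one = choi (Ad (mat 1 :: 'a cmat))"
  have one: "one \<in> S"
    using unitariesD(1)[OF B] by (auto simp: S_def one_def)
  define R where "R = span ((\<lambda>x. - one + x) ` (S - {one}))"
  have SR: "x - one \<in> R" if "x \<in> S" for x
    using that unfolding R_def by (cases "x = one") (auto intro!: span_base simp: span_0)
  \<comment> \<open>Adding to a map its conjugate under \<open>adj\<close> turns a coefficient
    \<open>c\<close> of a conjugation into \<open>2 * Re c\<close>. Letting \<open>c\<close> vary
    absorbs the case of a scalar multiple.\<close>
  have re: "choi (\<lambda>X. sm c (D X) + adj (sm c (D (adj X)))) \<in> R" if "D \<in> Ad_span B" for D c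
    using that
  proof (induction arbitrary: c rule: Ad_span.induct)
    case (diff U V)
    have "sm c X + adj (sm c (adj X)) = (2 * Re c) *\<^sub>R X" for X :: "'a cmat"
      by (simp add: adj_sm scaleR_eq_sm sm.add_left[symmetric] complex_add_cnj)
    then have "sm c (Ad U X - Ad V X) + adj (sm c (Ad U (adj X) - Ad V (adj X)))
       = (2 * Re c) *\<^sub>R (Ad U X - Ad V X)" for X
      by (simp flip: adj_Ad adj_linear(2))
    then have "choi (\<lambda>X. sm c (Ad U X - Ad V X) + adj (sm c (Ad U (adj X) - Ad V (adj X))))
      = (2 * Re c) *\<^sub>R ((choi (Ad U) - one) - (choi (Ad V) - one))"
      by (simp add: choi_def vec_eq_iff)
    moreover have "choi (Ad U) - one \<in> R" "choi (Ad V) - one \<in> R"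
      using diff by (auto intro!: SR simp: S_def)
    then have "(2 * Re c) *\<^sub>R ((choi (Ad U) - one) - (choi (Ad V) - one)) \<in> R"
      unfolding R_def by (rule span_scale[OF span_diff])
    ultimately show ?case by simp
  next
    case (add S T)
    have "choi (\<lambda>X. sm c (S X + T X) + adj (sm c (S (adj X) + T (adj X)))) =
      choi (\<lambda>X. sm c (S X) + adj (sm c (S (adj X)))) + choi (\<lambda>X. sm c (T X) + adj (sm c (T (adj X))))"
      by (simp add: choi_def vec_eq_iff cmat_simps)
    then show ?case
      using add.IH unfolding R_def by (simp add: span_add)
  next
    case (scale T d)
    then show ?case by simp
  qed
  have "sm (1/2) (\<Delta> X) + adj (sm (1/2) (\<Delta> (adj X))) = \<Delta> X" for X
    by (simp add: \<Delta>_def herm cmat_simps) (simp add: vec_eq_iff cmat_smult_def)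
  with re[OF \<Delta>, of "1/2"] have "choi \<Delta> \<in> R" by simp
  then have "- choi \<Delta> \<in> R" unfolding R_def by (rule span_neg)
  then have "one + (- choi \<Delta>) \<in> affine hull S"
    unfolding affine_hull_span2[OF one] R_def by blast
  also have "one + (- choi \<Delta>) = choi T"
    by (simp add: one_def \<Delta>_def choi_def vec_eq_iff)
  also have "affine hull S = affine hull (Ad_hull B)"
    by (simp add: Ad_hull_def S_def)
  finally show ?thesis .
qed

text \<open>The invariant average is a relative interior point, so points of the affine hull close
  to it lie in the hull itself, whose members come from mixed unitary maps.\<close>

lemma mixed_unitary_near_avg:
  assumes B: "star_algebra B"
  obtains n w U \<epsilon> where "unitary_weights B n w U" "\<epsilon> > 0"
    "\<And>V X. V \<in> unitaries B \<Longrightarrow> Ad V (avg n w U X) = avg n w U X"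
    "\<And>V X. V \<in> unitaries B \<Longrightarrow> avg n w U (Ad V X) = avg n w U X"
    "\<And>T. clinear_map T \<Longrightarrow> choi T \<in> affine hull (Ad_hull B) \<Longrightarrow>
      dist (choi T) (choi (avg n w U)) < \<epsilon> \<Longrightarrow> mixed_unitary T"
proof -
  obtain n w U where U: "unitary_weights B n w U"
    "\<And>V X. V \<in> unitaries B \<Longrightarrow> Ad V (avg n w U X) = avg n w U X"
    "\<And>V X. V \<in> unitaries B \<Longrightarrow> avg n w U (Ad V X) = avg n w U X"
    using invariant_avg[OF B] by metis
  obtain e where e: "e > 0" "ball (choi (avg n w U)) e \<inter> affine hull (Ad_hull B) \<subseteq> Ad_hull B"
    using avg_in_rel_interior[OF B U(1,3)] mem_rel_interior_ball by blast
  have "mixed_unitary T" if T: "clinear_map T" "choi T \<in> affine hull (Ad_hull B)"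
    "dist (choi T) (choi (avg n w U)) < e" for T
  proof -
    have "choi T \<in> Ad_hull B"
      using e(2) T(2,3) by (auto simp: dist_commute)
    then obtain m v W where "unitary_weights B m v W" "choi T = choi (avg m v W)"
      using Ad_hull_iff by blast
    then show ?thesis
      using choi_inject[OF T(1) clinear_map_avg] mixed_unitary_avg by metis
  qed
  with U e(1) that show thesis by blast
qed

section \<open>Multiplicative domains of unital channels\<close>

text \<open>The complex-valued inner product, conjugate-linear in the first argument;
  \<open>inner\<close> is its real part.\<close>

definition cin :: "complex^'d::finite \<Rightarrow> complex^'d \<Rightarrow> complex" where
  "cin u v = (\<Sum>a\<in>UNIV. cnj (u $ a) * v $ a)"

lemma cin_simps:
  "cin (u + v) w = cin u w + cin v w" "cin w (u + v) = cin w u + cin w v"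
  "cin (u - v) w = cin u w - cin v w" "cin w (u - v) = cin w u - cin w v"
  "cin (- v) w = - cin v w" "cin w (- v) = - cin w v"
  "cin (c *s v) w = cnj c * cin v w" "cin w (c *s v) = c * cin w v"
  by (simp_all add: cin_def algebra_simps sum.distrib sum_subtractf sum_distrib_left sum_negf)

lemma cin_sum: "cin (\<Sum>i\<in>I. f i) w = (\<Sum>i\<in>I. cin (f i) w)" "cin w (\<Sum>i\<in>I. f i) = (\<Sum>i\<in>I. cin w (f i))"
  by (simp_all add: cin_def sum_distrib_left sum_distrib_right sum.swap[of _ UNIV])

lemma cin_commute: "cin v u = cnj (cin u v)"
  by (simp add: cin_def mult.commute)

lemma cin_same: "cin u u = of_real ((norm u)\<^sup>2)"
proof -
  have "(norm u)\<^sup>2 = (\<Sum>a\<in>UNIV. (cmod (u $ a))\<^sup>2)"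
    by (simp add: norm_vec_def L2_set_def sum_nonneg)
  then show ?thesis
    by (simp add: cin_def complex_norm_square mult.commute del: of_real_power)
qed

lemma cin_mul: "cin u (A *v v) = (\<Sum>a\<in>UNIV. \<Sum>b\<in>UNIV. cnj (u $ a) * A $ a $ b * v $ b)"
  by (simp add: cin_def matrix_vector_mult_def sum_distrib_left mult.assoc)

lemma cin_adj: "cin u (adj A *v v) = cin (A *v u) v"
  by (simp add: cin_def matrix_vector_mult_def adjoint_mat_def sum_distrib_left sum_distrib_right mult_ac)
    (rule sum.swap)

lemma mat_vec_simps: "A *v (c *s v) = c *s (A *v v)" "A *v (- v) = - (A *v v)" for A :: "'d::finite cmat"
  by (simp_all add: vec_eq_iff matrix_vector_mult_def sum_distrib_left sum_negf mult_ac)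

lemma cin_axis: "cin (axis a 1) (A *v axis b 1) = A $ a $ b"
proof -
  have "cin (axis a 1) w = w $ a" for w :: "complex^'a"
  proof -
    have "cnj (axis a 1 $ i) * w $ i = (if i = a then w $ i else 0)" for i
      by (simp add: axis_def)
    then show ?thesis by (simp add: cin_def)
  qed
  moreover have "(A *v axis b 1) $ a = A $ a $ b"
  proof -
    have "A $ a $ i * axis b 1 $ i = (if i = b then A $ a $ i else 0)" for i
      by (simp add: axis_def)
    then show ?thesis by (simp add: matrix_vector_mult_def)
  qed
  ultimately show ?thesis by simp
qed

lemma cin_axis_trace: "trace A = (\<Sum>a\<in>UNIV. cin (axis a 1) (A *v axis a 1))"
  by (simp add: cin_axis trace_def)

text \<open>Reality at \<open>c = 0, 1, i\<close> forces \<open>b' = cnj b\<close>; the expression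
  is then \<open>Re a + 2 * Re (c * b)\<close>, unbounded below unless \<open>b = 0\<close>.\<close>

lemma cross_term_zero:
  fixes a b b' :: complex
  assumes "\<And>c. Im (a + c * b + cnj c * b') = 0" "\<And>c. Re (a + c * b + cnj c * b') \<ge> 0"
  shows "b = 0"
proof (rule ccontr)
  assume "b \<noteq> 0"
  have "Im a = 0" using assms(1)[of 0] by simp
  then have "b' = cnj b"
    using assms(1)[of 1] assms(1)[of \<i>] by (simp add: complex_eq_iff)
  \<comment> \<open>At \<open>c = - r * cnj b\<close> this choice gives the value
    \<open>- Re a - 2\<close>, negative because \<open>Re a \<ge> 0\<close>.\<close>
  define r where "r = (Re a + 1) / (cmod b)\<^sup>2"
  have "Re (a + of_real (- r) * cnj b * b + cnj (of_real (- r) * cnj b) * b') = Re a - 2 * r * (cmod b)\<^sup>2"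
    using \<open>b' = cnj b\<close> unfolding cmod_power2 by (simp add: power2_eq_square algebra_simps)
  also have "\<dots> = - Re a - 2"
    using \<open>b \<noteq> 0\<close> by (simp add: r_def)
  finally show False
    using assms(2)[of "of_real (- r) * cnj b"] assms(2)[of 0] by simp
qed

text \<open>A nonnegative diagonal with sum zero vanishes. The form at \<open>e_a + c e_b\<close>
  then has no term quadratic in \<open>c\<close>, and \<open>cross_term_zero\<close> kills the entry
  at \<open>a, b\<close>.\<close>

lemma psd_trace_zero:
  assumes psd: "\<And>u. Im (cin u (S *v u)) = 0" "\<And>u. Re (cin u (S *v u)) \<ge> 0"
    and tr: "Re (trace S) = 0"
  shows "S = 0"
proof -
  have "\<forall>a\<in>UNIV. Re (cin (axis a 1) (S *v axis a 1)) = 0"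
    using tr psd(2) unfolding cin_axis_trace by (simp add: sum_nonneg_eq_0_iff)
  then have diag: "cin (axis a 1) (S *v axis a 1) = 0" for a
    using psd(1)[of "axis a 1"] by (simp add: complex_eq_iff)
  have "S $ a $ b = 0" for a b
  proof -
    let ?u = "axis a 1 :: complex^'a" and ?e = "axis b 1 :: complex^'a"
    have expand: "cin (?u + c *s ?e) (S *v (?u + c *s ?e)) =
        cin ?u (S *v ?u) + c * cin ?u (S *v ?e) + cnj c * cin ?e (S *v ?u)" for c
      using diag[of b] by (simp add: matrix_vector_right_distrib mat_vec_simps cin_simps algebra_simps)
    have "cin ?u (S *v ?e) = 0"
      by (rule cross_term_zero[where a = "cin ?u (S *v ?u)" and b' = "cin ?e (S *v ?u)"])
        (unfold expand[symmetric], (rule psd)+)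
    then show ?thesis by (simp add: cin_axis)
  qed
  then show ?thesis by (simp add: vec_eq_iff)
qed

lemma block_psd_iff:
  "block_psd k X \<longleftrightarrow> (\<forall>v. Im (\<Sum>i<k. \<Sum>j<k. cin (v i) (X i j *v v j)) = 0 \<and>
     Re (\<Sum>i<k. \<Sum>j<k. cin (v i) (X i j *v v j)) \<ge> 0)"
  by (simp add: block_psd_def Let_def cin_mul)

text \<open>The form at \<open>v\<close> is the squared norm of the sum of the vectors
  \<open>Z i *v v i\<close>.\<close>

lemma block_psd_gram: "block_psd k (\<lambda>i j. adj (Z i) ** Z j)"
proof -
  have "(\<Sum>i<k. \<Sum>j<k. cin (v i) ((adj (Z i) ** Z j) *v v j)) = of_real ((norm (\<Sum>i<k. Z i *v v i))\<^sup>2)" for v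
    unfolding cin_same[symmetric]
    by (simp add: cin_adj cin_sum flip: matrix_vector_mul_assoc) (rule sum.swap)
  then show ?thesis by (simp add: block_psd_iff del: of_real_power)
qed

section \<open>The Schwarz inequality and its equality case\<close>

context
  fixes \<Phi> :: "'d::finite cmat \<Rightarrow> 'd cmat"
  assumes ch: "unital_channel \<Phi>"
begin

lemma channel_linear: "clinear_map \<Phi>"
  and channel_one: "\<Phi> (mat 1) = mat 1" and channel_trace: "trace (\<Phi> X) = trace X"
  using ch by (auto simp: unital_channel_def)

text \<open>Complete positivity for \<open>k = 2\<close>, applied to the Gram matrix of the pair
  \<open>X, mat 1\<close> and evaluated at the vectors \<open>u, v\<close>.\<close>

lemma channel_block:
  shows "Im (cin u (\<Phi> (adj X ** X) *v u) + cin u (\<Phi> (adj X) *v v) + cin v (\<Phi> X *v u) + cin v v) = 0" (is ?A)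
    and "Re (cin u (\<Phi> (adj X ** X) *v u) + cin u (\<Phi> (adj X) *v v) + cin v (\<Phi> X *v u) + cin v v) \<ge> 0" (is ?B)
proof -
  define Z where "Z = (\<lambda>i::nat. if i = 0 then X else mat 1)"
  define w where "w = (\<lambda>i::nat. if i = 0 then u else v)"
  have "block_psd 2 (\<lambda>i j. \<Phi> (adj (Z i) ** Z j))"
    using ch block_psd_gram unfolding unital_channel_def completely_positive_def by blast
  then have "Im (\<Sum>i<2. \<Sum>j<2. cin (w i) (\<Phi> (adj (Z i) ** Z j) *v w j)) = 0 \<and>
     Re (\<Sum>i<2. \<Sum>j<2. cin (w i) (\<Phi> (adj (Z i) ** Z j) *v w j)) \<ge> 0"
    unfolding block_psd_iff by blast
  moreover have "(\<Sum>i<2. \<Sum>j<2. cin (w i) (\<Phi> (adj (Z i) ** Z j) *v w j)) =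
    cin u (\<Phi> (adj X ** X) *v u) + cin u (\<Phi> (adj X) *v v) + cin v (\<Phi> X *v u) + cin v v"
    by (simp add: numeral_2_eq_2 Z_def w_def channel_one)
  ultimately show ?A ?B by simp_all
qed

text \<open>Comparing \<open>v\<close> with \<open>- v\<close> in the block form shows that the
  sesquilinear form of \<open>G\<close> is always real; replacing \<open>v\<close> by
  \<open>i v\<close> makes it zero.\<close>

lemma channel_adj: "\<Phi> (adj X) = adj (\<Phi> X)"
proof -
  define G where "G = \<Phi> (adj X) - adj (\<Phi> X)"
  have im: "Im (cin u (G *v v)) = 0" for u v
  proof -
    have "Im (cin u (\<Phi> (adj X) *v v) + cin v (\<Phi> X *v u)) = 0"
      using channel_block(1)[of u X v] channel_block(1)[of u X "- v"]
      by (simp add: cin_simps mat_vec_simps)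
    moreover have "cin v (\<Phi> X *v u) = cnj (cin u (adj (\<Phi> X) *v v))"
      by (simp add: cin_adj cin_commute[of v])
    ultimately show ?thesis
      by (simp add: G_def matrix_vector_mult_diff_rdistrib cin_simps)
  qed
  have "cin u (G *v v) = 0" for u v
    using im[of u v] im[of u "\<i> *s v"]
    by (simp add: mat_vec_simps cin_simps complex_eq_iff)
  then have "G $ a $ b = 0" for a b
    by (metis cin_axis)
  then have "G = 0" by (simp add: vec_eq_iff)
  then show ?thesis by (simp add: G_def)
qed

text \<open>The block form at \<open>v = - (\<Phi> X *v u)\<close>, which completes the
  square.\<close>

lemma channel_Schwarz:
  shows "Im (cin u ((\<Phi> (adj X ** X) - \<Phi> (adj X) ** \<Phi> X) *v u)) = 0"
    and "Re (cin u ((\<Phi> (adj X ** X) - \<Phi> (adj X) ** \<Phi> X) *v u)) \<ge> 0"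
  using channel_block[of u X "- (\<Phi> X *v u)"]
  by (simp_all add: cin_simps mat_vec_simps matrix_vector_mult_diff_rdistrib
      flip: matrix_vector_mul_assoc)

text \<open>Links the norm with the Schwarz defect: the norm is preserved when this positive
  semidefinite matrix has trace zero.\<close>

lemma trace_channel_defect:
  "trace (\<Phi> (adj X ** X) - \<Phi> (adj X) ** \<Phi> X) = of_real ((norm X)\<^sup>2 - (norm (\<Phi> X))\<^sup>2)"
  by (simp only: trace_diff_cmat channel_trace channel_adj norm_cmat_trace of_real_diff)

lemma channel_contraction: "norm (\<Phi> X) \<le> norm X"
proof -
  have "0 \<le> Re (trace (\<Phi> (adj X ** X) - \<Phi> (adj X) ** \<Phi> X))"
    unfolding cin_axis_trace Re_sum by (intro sum_nonneg channel_Schwarz)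
  then have "(norm (\<Phi> X))\<^sup>2 \<le> (norm X)\<^sup>2"
    unfolding trace_channel_defect by simp
  then show ?thesis by simp
qed

text \<open>The defect \<open>D X X\<close> is positive semidefinite with trace zero, so it
  vanishes. The defect at \<open>Y + c X\<close> is then real affine in \<open>c\<close> and never
  negative, which forces the cross term \<open>D Y X\<close> to vanish. The other identity follows
  by adjoints.\<close>

lemma multiplicative_domain:
  assumes "norm (\<Phi> X) = norm X"
  shows "\<Phi> (Y ** X) = \<Phi> Y ** \<Phi> X" "\<Phi> (X ** Y) = \<Phi> X ** \<Phi> Y"
proof -
  have *: "\<Phi> (Y ** X) = \<Phi> Y ** \<Phi> X" if X: "norm (\<Phi> X) = norm X" for X Y
  proof -
    define D where "D Y X = \<Phi> (adj Y ** X) - \<Phi> (adj Y) ** \<Phi> X" for Y X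
    note cl = clinear_mapD[OF channel_linear]
    have "D X X = 0"
      using channel_Schwarz trace_channel_defect[of X] X unfolding D_def
      by (intro psd_trace_zero) auto
    have "D Y X = 0" for Y
    proof -
      have "cin v (D Y X *v v) = 0" for v
      proof (rule cross_term_zero)
        fix c
        have "D (Y + sm c X) (Y + sm c X) = D Y Y + sm c (D Y X) + sm (cnj c) (D X Y) + sm (cnj c * c) (D X X)"
          by (simp add: D_def cl cmat_simps mult.commute)
        then have "cin v (D (Y + sm c X) (Y + sm c X) *v v) =
            cin v (D Y Y *v v) + c * cin v (D Y X *v v) + cnj c * cin v (D X Y *v v)"
          unfolding \<open>D X X = 0\<close> sm.zero_right
          by (simp add: matrix_vector_mult_add_rdistrib cin_simps)
            (simp add: cin_mul cmat_smult_def sum_distrib_left mult_ac)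
        then show "Im (cin v (D Y Y *v v) + c * cin v (D Y X *v v) + cnj c * cin v (D X Y *v v)) = 0"
          "Re (cin v (D Y Y *v v) + c * cin v (D Y X *v v) + cnj c * cin v (D X Y *v v)) \<ge> 0"
          using channel_Schwarz[of v "Y + sm c X"] unfolding D_def by metis+
      qed
      then show ?thesis
        by (intro psd_trace_zero) (simp_all add: cin_axis_trace)
    qed
    from this[of "adj Y"] show ?thesis by (simp add: D_def)
  qed
  from assms show "\<Phi> (Y ** X) = \<Phi> Y ** \<Phi> X" by (rule *)
  have "norm (\<Phi> (adj X)) = norm (adj X)" using assms by (simp add: channel_adj)
  from arg_cong[OF *[OF this, of "adj Y"], of adj]
  show "\<Phi> (X ** Y) = \<Phi> X ** \<Phi> Y"
    by (simp add: adj_mul channel_adj flip: channel_adj[of "adj Y ** adj X"])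
qed

text \<open>The right-hand side makes closure under sums and products visible, which the norm
  condition hides.\<close>

lemma norm_channel_iff:
  "norm (\<Phi> X) = norm X \<longleftrightarrow> (\<forall>Y. \<Phi> (Y ** X) = \<Phi> Y ** \<Phi> X \<and> \<Phi> (X ** Y) = \<Phi> X ** \<Phi> Y)"
proof
  assume "norm (\<Phi> X) = norm X"
  then show "\<forall>Y. \<Phi> (Y ** X) = \<Phi> Y ** \<Phi> X \<and> \<Phi> (X ** Y) = \<Phi> X ** \<Phi> Y"
    using multiplicative_domain by blast
next
  assume "\<forall>Y. \<Phi> (Y ** X) = \<Phi> Y ** \<Phi> X \<and> \<Phi> (X ** Y) = \<Phi> X ** \<Phi> Y"
  then have "\<Phi> (adj X ** X) - \<Phi> (adj X) ** \<Phi> X = 0" by simp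
  then have "complex_of_real ((norm X)\<^sup>2 - (norm (\<Phi> X))\<^sup>2) = 0"
    by (simp only: trace_channel_defect[symmetric]) (simp add: trace_def)
  then have "(norm X)\<^sup>2 - (norm (\<Phi> X))\<^sup>2 = 0" by (simp only: of_real_eq_0_iff)
  then show "norm (\<Phi> X) = norm X" by simp
qed

end

section \<open>Implementing automorphisms by unitaries\<close>

text \<open>The estimated matrix is the defect \<open>1 - adj Z ** Z\<close> after one Newton-Schulz
  step from a defect \<open>\<Delta>\<close>. The factor obtained is
  \<open>3/8 + 1/16 < 1/2\<close>.\<close>

lemma norm_mul_cubic:
  fixes \<Delta> :: "'d::finite cmat"
  assumes "norm \<Delta> \<le> 1/2"
  shows "norm ((3/4) *\<^sub>R (\<Delta> ** \<Delta>) + (1/4) *\<^sub>R (\<Delta> ** \<Delta> ** \<Delta>)) \<le> (1/2) * norm \<Delta>"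
proof -
  define d where "d = norm \<Delta>"
  have d: "0 \<le> d" "d \<le> 1/2" using assms by (simp_all add: d_def)
  have 1: "norm (\<Delta> ** \<Delta>) \<le> (1/2) * d"
    using norm_cmat_mult[of \<Delta> \<Delta>] mult_right_mono[OF d(2) d(1)] by (simp add: d_def)
  have "norm (\<Delta> ** \<Delta> ** \<Delta>) \<le> norm (\<Delta> ** \<Delta>) * d"
    using norm_cmat_mult[of "\<Delta> ** \<Delta>" \<Delta>] by (simp add: d_def)
  also have "\<dots> \<le> (1/2) * d * d" using 1 d by (intro mult_right_mono)
  also have "\<dots> \<le> (1/2) * d * (1/2)" using d by (intro mult_left_mono) auto
  finally have 2: "norm (\<Delta> ** \<Delta> ** \<Delta>) \<le> (1/2) * d * (1/2)" .
  have "norm ((3/4) *\<^sub>R (\<Delta> ** \<Delta>) + (1/4) *\<^sub>R (\<Delta> ** \<Delta> ** \<Delta>)) \<le>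
      (3/4) * norm (\<Delta> ** \<Delta>) + (1/4) * norm (\<Delta> ** \<Delta> ** \<Delta>)"
    by (rule norm_triangle_le) simp
  also have "\<dots> \<le> (1/2) * d" using 1 2 d by simp
  finally show ?thesis by (simp add: d_def)
qed

text \<open>An intertwiner \<open>Y\<close> minimizing \<open>\<parallel>1 - Y\<^sup>* Y\<parallel>\<close> is unitary, since otherwise the Newton-Schulz step
  \<open>Y (3 - Y\<^sup>* Y) / 2\<close> would decrease this norm.\<close>

lemma unitary_intertwiner:
  fixes \<alpha> :: "'d::finite cmat \<Rightarrow> 'd cmat"
  assumes star: "\<And>W. W \<in> S \<Longrightarrow> adj W \<in> S \<and> \<alpha> (adj W) = adj (\<alpha> W)"
    and Q: "\<And>W. W \<in> S \<Longrightarrow> Q ** W = \<alpha> W ** Q" "norm (mat 1 - adj Q ** Q) \<le> 1/2"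
  obtains U where "unitary_mat U" "\<And>W. W \<in> S \<Longrightarrow> U ** W = \<alpha> W ** U"
proof -
  define I where "I = {Y. (\<forall>W\<in>S. Y ** W = \<alpha> W ** Y) \<and> norm (mat 1 - adj Y ** Y) \<le> 1/2}"
  have cont: "continuous_on A (\<lambda>Y. norm (mat 1 - adj Y ** Y))" for A :: "'d cmat set"
    by (intro continuous_on_norm continuous_on_diff continuous_on_const mm.continuous_on
        continuous_on_id linear_continuous_on[OF bounded_linear_adj])
  have "closed I"
  proof -
    have "I = (\<Inter>W\<in>S. {Y. Y ** W = \<alpha> W ** Y}) \<inter> {Y. norm (mat 1 - adj Y ** Y) \<le> 1/2}"
      by (auto simp: I_def)
    moreover have "closed {Y. Y ** W = \<alpha> W ** Y}" for W
      by (intro closed_Collect_eq mm.continuous_on continuous_on_const continuous_on_id)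
    moreover have "closed {Y :: 'd cmat. norm (mat 1 - adj Y ** Y) \<le> 1/2}"
      by (intro closed_Collect_le cont continuous_on_const)
    ultimately show ?thesis by auto
  qed
  moreover have "bounded I"
    unfolding bounded_iff
  proof (intro exI ballI)
    fix Y assume "Y \<in> I"
    then have "norm (mat 1 - adj Y ** Y) \<le> 1/2" by (simp add: I_def)
    then have le: "norm (adj Y ** Y) \<le> norm (mat 1 :: 'd cmat) + 1/2"
      using norm_triangle_ineq2[of "adj Y ** Y" "mat 1"] by (simp add: norm_minus_commute)
    have "(norm Y)\<^sup>2 = mat 1 \<bullet> (adj Y ** Y)"
      using norm_cmat_trace[of Y] by (simp add: inner_cmat flip: norm_cmat_trace)
    also have "\<dots> \<le> norm (mat 1 :: 'd cmat) * (norm (mat 1 :: 'd cmat) + 1/2)"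
      using norm_cauchy_schwarz[of "mat 1" "adj Y ** Y"] mult_left_mono[OF le norm_ge_zero[of "mat 1 :: 'd cmat"]]
      by linarith
    finally show "norm Y \<le> sqrt (norm (mat 1 :: 'd cmat) * (norm (mat 1 :: 'd cmat) + 1/2))"
      by (rule real_le_rsqrt)
  qed
  ultimately have "compact I" by (simp add: compact_eq_bounded_closed)
  moreover have "I \<noteq> {}" using Q by (auto simp: I_def)
  ultimately obtain Y where Y: "Y \<in> I"
    and min: "\<And>Z. Z \<in> I \<Longrightarrow> norm (mat 1 - adj Y ** Y) \<le> norm (mat 1 - adj Z ** Z)"
    using continuous_attains_inf[OF _ _ cont] by metis
  define \<Delta> where "\<Delta> = mat 1 - adj Y ** Y"
  \<comment> \<open>The Newton-Schulz step, since
    \<open>(3 - adj Y ** Y) / 2 = 1 + \<Delta> / 2\<close>.\<close>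
  define Z where "Z = Y + (1/2) *\<^sub>R (Y ** \<Delta>)"
  have YY: "adj Y ** Y = mat 1 - \<Delta>" "adj \<Delta> = \<Delta>"
    by (simp_all add: \<Delta>_def cmat_simps)
  have YW: "Y ** W = \<alpha> W ** Y" if "W \<in> S" for W
    using Y that by (simp add: I_def)
  have "norm \<Delta> \<le> 1/2" using Y by (simp add: I_def \<Delta>_def)
  have "adj Z ** Z = (mat 1 + (1/2) *\<^sub>R \<Delta>) ** (adj Y ** Y) ** (mat 1 + (1/2) *\<^sub>R \<Delta>)"
    by (simp add: Z_def cmat_simps YY(2))
  also have "\<dots> = mat 1 - ((3/4) *\<^sub>R (\<Delta> ** \<Delta>) + (1/4) *\<^sub>R (\<Delta> ** \<Delta> ** \<Delta>))"
    unfolding YY(1) by (simp add: cmat_simps algebra_simps, simp add: vec_eq_iff algebra_simps,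
        simp add: scaleR_conv_of_real field_simps)
  finally have ZZ: "mat 1 - adj Z ** Z = (3/4) *\<^sub>R (\<Delta> ** \<Delta>) + (1/4) *\<^sub>R (\<Delta> ** \<Delta> ** \<Delta>)" by simp
  have Z_le: "norm (mat 1 - adj Z ** Z) \<le> (1/2) * norm \<Delta>"
    unfolding ZZ by (rule norm_mul_cubic[OF \<open>norm \<Delta> \<le> 1/2\<close>])
  \<comment> \<open>As \<open>S\<close> is closed under adjoints, \<open>adj Y\<close> intertwines
    in the opposite direction; so \<open>\<Delta>\<close> commutes with \<open>S\<close>, and
    \<open>Z\<close> is again an intertwiner.\<close>
  have "Z ** W = \<alpha> W ** Z" if W: "W \<in> S" for W
  proof -
    have YW': "adj Y ** \<alpha> W = W ** adj Y"
      using arg_cong[OF YW[of "adj W"], of adj] star[OF W] by (simp add: adj_mul)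
    have "adj Y ** Y ** W = adj Y ** \<alpha> W ** Y"
      by (simp add: YW[OF W] flip: matrix_mul_assoc)
    then have \<Delta>W: "\<Delta> ** W = W ** \<Delta>"
      by (simp add: \<Delta>_def cmat_simps YW')
    have "Y ** \<Delta> ** W = Y ** W ** \<Delta>"
      by (simp add: \<Delta>W flip: matrix_mul_assoc)
    then show ?thesis
      using YW[OF W] by (simp add: Z_def cmat_simps)
  qed
  then have "Z \<in> I"
    using Z_le \<open>norm \<Delta> \<le> 1/2\<close> by (simp add: I_def)
  from min[OF this] Z_le have "norm \<Delta> = 0"
    unfolding \<Delta>_def[symmetric] using norm_ge_zero[of \<Delta>] by linarith
  then have "unitary_mat Y"
    using YY(1) by (intro unitary_matI) simp
  with YW that show thesis by blast
qed

text \<open>The point of least norm in the convex hull of the \<open>\<alpha>(V)\<^sup>* V\<close> is an intertwiner close to the identity.\<close>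

lemma unitary_implementation:
  assumes N: "star_algebra N" and \<alpha>: "clinear_map \<alpha>" "\<alpha> (mat 1) = mat 1"
    and mult: "\<And>V W. V \<in> unitaries N \<Longrightarrow> W \<in> unitaries N \<Longrightarrow> \<alpha> (V ** W) = \<alpha> V ** \<alpha> W"
    and star: "\<And>V. V \<in> unitaries N \<Longrightarrow> \<alpha> (adj V) = adj (\<alpha> V)"
    and small: "\<And>V. V \<in> unitaries N \<Longrightarrow> norm (\<alpha> V - V) \<le> 1/5"
  obtains U where "unitary_mat U" "\<And>V. V \<in> unitaries N \<Longrightarrow> \<alpha> V = U ** V ** adj U"
proof -
  define K where "K = convex hull ((\<lambda>V. adj (\<alpha> V) ** V) ` unitaries N)"
  have u\<alpha>: "unitary_mat (\<alpha> V)" if "V \<in> unitaries N" for V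
    using mult[OF unitariesD(5)[OF N that] that] star[OF that] unitary_matD(1)[OF unitariesD(3)[OF N that]] \<alpha>(2)
    by (intro unitary_matI) simp
  have conv: "convex K" by (simp add: K_def)
  have "compact K"
    unfolding K_def
    by (intro compact_convex_hull compact_continuous_image compact_unitaries N mm.continuous_on continuous_on_id
        linear_continuous_on[OF bounded_linear_compose[OF bounded_linear_adj clinear_mapD(4)[OF \<alpha>(1)]]])
  then have cl: "closed K" by (rule compact_imp_closed)
  have ne: "K \<noteq> {}" using unitariesD(1)[OF N] by (auto simp: K_def)
  define Q where "Q = closest_point K 0"
  have Q: "Q \<in> K" "\<And>z. z \<in> K \<Longrightarrow> norm Q \<le> norm z"
    using closest_point_exists[OF cl ne, of 0] by (auto simp: Q_def)
  have QW: "Q ** W = \<alpha> W ** Q" if W: "W \<in> unitaries N" for W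
  proof -
    \<comment> \<open>\<open>f\<close> carries the generator for \<open>V\<close> to the one for
      \<open>V ** W\<close> and preserves the norm, so it fixes the unique point of least norm;
      \<open>f Q = Q\<close> is the intertwining relation.\<close>
    define f where "f X = adj (\<alpha> W) ** X ** W" for X
    have "linear f"
      unfolding f_def
      by (intro bounded_linear.linear bounded_linear_compose[OF mm.bounded_linear_left] mm.bounded_linear_right)
    have "f ` K \<subseteq> K"
      unfolding K_def convex_hull_linear_image[OF \<open>linear f\<close>]
    proof (rule hull_mono, rule subsetI)
      fix x assume "x \<in> f ` (\<lambda>V. adj (\<alpha> V) ** V) ` unitaries N"
      then obtain V where "V \<in> unitaries N" "x = adj (\<alpha> (V ** W)) ** (V ** W)"
        using mult W by (auto simp: f_def adj_mul matrix_mul_assoc)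
      then show "x \<in> (\<lambda>V. adj (\<alpha> V) ** V) ` unitaries N"
        using unitariesD(4)[OF N _ W] by blast
    qed
    then have "f Q \<in> K" using Q(1) by blast
    moreover have "norm (f Q) = norm Q"
      by (simp add: f_def norm_unitary_mul unitary_mat_adj u\<alpha>[OF W] unitariesD(3)[OF N W])
    ultimately have "f Q = closest_point K 0"
      using Q(2) by (intro closest_point_unique[OF conv cl]) auto
    then have "\<alpha> W ** (adj (\<alpha> W) ** Q ** W) = \<alpha> W ** Q"
      by (simp add: Q_def f_def)
    then show ?thesis
      by (simp add: matrix_mul_assoc unitary_matD(2)[OF u\<alpha>[OF W]])
  qed
  have "K \<subseteq> cball (mat 1) (1/5)"
    unfolding K_def
  proof (rule hull_minimal, rule image_subsetI)
    fix V assume V: "V \<in> unitaries N"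
    have "mat 1 - adj (\<alpha> V) ** V = adj (\<alpha> V) ** (\<alpha> V - V)"
      by (simp add: mm.diff_right unitary_matD[OF u\<alpha>[OF V]])
    then show "adj (\<alpha> V) ** V \<in> cball (mat 1) (1/5)"
      using small[OF V] by (simp add: dist_norm norm_unitary_mul unitary_mat_adj u\<alpha>[OF V])
  qed (rule convex_cball)
  with Q(1) have R: "norm (mat 1 - Q) \<le> 1/5" by (auto simp: dist_norm)
  define R where "R = mat 1 - Q"
  have "mat 1 - adj Q ** Q = adj R + R - adj R ** R"
    by (simp add: R_def cmat_simps)
  also have "norm \<dots> \<le> norm (adj R) + norm R + norm (adj R ** R)"
    by (meson norm_triangle_ineq4 norm_triangle_ineq order_trans add_right_mono)
  \<comment> \<open>The bound \<open>1/5\<close> in \<open>small\<close> is chosen for this: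
    \<open>1/5 + 1/5 + 1/25 = 11/25\<close> is below the \<open>1/2\<close> that
    \<open>unitary_intertwiner\<close> asks for.\<close>
  also have "\<dots> \<le> 1/5 + 1/5 + 1/5 * (1/5)"
  proof -
    have "norm (adj R ** R) \<le> norm R * norm R" using norm_cmat_mult[of "adj R" R] by simp
    also have "\<dots> \<le> 1/5 * (1/5)" using R by (intro mult_mono) (auto simp: R_def)
    finally show ?thesis using R by (simp add: R_def)
  qed
  finally have "norm (mat 1 - adj Q ** Q) \<le> 1/2" by simp
  then obtain U where U: "unitary_mat U" "\<And>W. W \<in> unitaries N \<Longrightarrow> U ** W = \<alpha> W ** U"
    using unitary_intertwiner[of "unitaries N" \<alpha> Q] star unitariesD(5)[OF N] QW by metis
  then have "\<alpha> V = U ** V ** adj U" if "V \<in> unitaries N" for V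
    using that by (simp add: unitary_matD)
  with U(1) that show thesis by blast
qed

section \<open>Linear maps as sums of two-sided multiplications\<close>

lemma munit_sandwich: "munit a i ** X ** munit j b = sm (X $ i $ j) (munit a b)"
proof -
  have "(\<Sum>k\<in>UNIV. (\<Sum>l\<in>UNIV. munit a i $ p $ l * X $ l $ k) * munit j b $ k $ q) = X $ i $ j * munit a b $ p $ q" for p q
  proof -
    have "(\<Sum>l\<in>UNIV. munit a i $ p $ l * X $ l $ k) = (if p = a then X $ i $ k else 0)" for k
    proof -
      have "munit a i $ p $ l * X $ l $ k = (if l = i then (if p = a then X $ i $ k else 0) else 0)" for l
        by (simp add: munit_def)
      then show ?thesis by simp
    qed
    moreover have "(\<Sum>k\<in>UNIV. c k * munit j b $ k $ q) = (if q = b then c j else 0)" for c :: "'a \<Rightarrow> complex"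
    proof -
      have "c k * munit j b $ k $ q = (if k = j then (if q = b then c j else 0) else 0)" for k
        by (simp add: munit_def)
      then show ?thesis by simp
    qed
    ultimately have "(\<Sum>k\<in>UNIV. (\<Sum>l\<in>UNIV. munit a i $ p $ l * X $ l $ k) * munit j b $ k $ q) =
        (if q = b then if p = a then X $ i $ j else 0 else 0)"
      by simp
    then show ?thesis by (simp add: munit_def)
  qed
  then show ?thesis
    by (simp add: vec_eq_iff matrix_matrix_mult_def cmat_smult_def)
qed

text \<open>\<open>munit a i ** X ** munit j b\<close> moves the entry \<open>X $ i $ j\<close> to
  position \<open>a, b\<close>; with the matrix coefficients of \<open>T\<close> as weights,
  quadruples of indices suffice.\<close>

lemma sandwich_representation:
  fixes T :: "'d::finite cmat \<Rightarrow> 'd cmat"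
  assumes "clinear_map T"
  obtains x y :: "'d \<times> 'd \<times> 'd \<times> 'd \<Rightarrow> 'd cmat" where "\<And>X. T X = (\<Sum>k\<in>UNIV. x k ** X ** y k)"
proof
  fix X
  define x where "x = (\<lambda>(i, j, a, b). sm (T (munit i j) $ a $ b) (munit a i))"
  define y where "y = (\<lambda>(i::'d, j::'d, a::'d, b). munit j b)"
  have "T X = (\<Sum>i\<in>UNIV. \<Sum>j\<in>UNIV. sm (X $ i $ j) (\<Sum>a\<in>UNIV. \<Sum>b\<in>UNIV. sm (T (munit i j) $ a $ b) (munit a b)))"
    by (subst clinear_map_expansion[OF assms]) (simp flip: munit_expansion)
  also have "\<dots> = (\<Sum>i\<in>UNIV. \<Sum>j\<in>UNIV. \<Sum>a\<in>UNIV. \<Sum>b\<in>UNIV. x (i, j, a, b) ** X ** y (i, j, a, b))"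
    by (simp add: x_def y_def mul_sm_left munit_sandwich sm.sum_right mult.commute)
  also have "\<dots> = (\<Sum>k\<in>UNIV. x k ** X ** y k)"
    by (simp add: sum.cartesian_product split_def flip: UNIV_Times_UNIV)
  finally show "T X = (\<Sum>k\<in>UNIV. (\<lambda>(i, j, a, b). sm (T (munit i j) $ a $ b) (munit a i)) k ** X **
      (\<lambda>(i::'d, j::'d, a::'d, b). munit j b) k)"
    unfolding x_def y_def .
qed

text \<open>Take any representation of \<open>T\<close>. Averaging
  \<open>adj V ** T (V ** X)\<close> over unitaries of \<open>N\<close> leaves \<open>T\<close>
  unchanged and replaces the left coefficients by invariant averages, which lie in the commutant.
  Then the right coefficients are treated in the same way.\<close>

lemma bimodule_map_representation:
  fixes T :: "'d::finite cmat \<Rightarrow> 'd cmat"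
  assumes N: "star_algebra N" and T: "clinear_map T"
    and left: "\<And>V X. V \<in> unitaries N \<Longrightarrow> T (V ** X) = V ** T X"
    and right: "\<And>V X. V \<in> unitaries N \<Longrightarrow> T (X ** V) = T X ** V"
  shows "\<exists>a b :: 'd \<times> 'd \<times> 'd \<times> 'd \<Rightarrow> 'd cmat.
    (\<forall>k. a k \<in> commutant N \<and> b k \<in> commutant N) \<and> (\<forall>X. T X = (\<Sum>k\<in>UNIV. a k ** X ** b k))"
proof -
  obtain x y :: "'d \<times> 'd \<times> 'd \<times> 'd \<Rightarrow> 'd cmat" where xy: "\<And>X. T X = (\<Sum>k\<in>UNIV. x k ** X ** y k)"
    by (rule sandwich_representation[OF T]) blast
  obtain m v V where V: "unitary_weights N m v V"
    "\<And>W X. W \<in> unitaries N \<Longrightarrow> Ad W (avg m v V X) = avg m v V X"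
    using left_invariant_avg[OF N] by metis
  define P where "P = avg m v V"
  have Vj: "V j \<in> unitaries N" "unitary_mat (V j)" "adj (V j) \<in> unitaries N" if "j < m" for j
    using V(1) that unitariesD[OF N] by (auto simp: unitary_weights_def)
  have sum1: "(\<Sum>j<m. v j *\<^sub>R X) = X" for X :: "'d cmat"
    using V(1) by (simp add: unitary_weights_def flip: scaleR_sum_left)
  have PN: "P X \<in> commutant N" for X
    unfolding commutant_def P_def using avg_commutes[OF N _ V(2)] by blast
  have 1: "T X = (\<Sum>k\<in>UNIV. P (x k) ** X ** y k)" for X
  proof -
    have "(\<Sum>j<m. v j *\<^sub>R T X) = (\<Sum>j<m. v j *\<^sub>R (adj (V j) ** T (V j ** X)))"
      by (intro sum.cong) (simp_all add: left Vj matrix_mul_assoc unitary_matD)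
    then have "T X = (\<Sum>j<m. v j *\<^sub>R (adj (V j) ** T (V j ** X)))"
      by (simp only: sum1)
    also have "\<dots> = (\<Sum>j<m. \<Sum>k\<in>UNIV. (v j *\<^sub>R (adj (V j) ** x k ** V j)) ** X ** y k)"
      by (simp add: xy cmat_simps scaleR_sum_right)
    also have "\<dots> = (\<Sum>k\<in>UNIV. P (x k) ** X ** y k)"
      unfolding P_def avg_def Ad_def mm.sum_left by (rule sum.swap)
    finally show ?thesis .
  qed
  have "T X = (\<Sum>k\<in>UNIV. P (x k) ** X ** P (y k))" for X
  proof -
    have "(\<Sum>j<m. v j *\<^sub>R T X) = (\<Sum>j<m. v j *\<^sub>R (T (X ** adj (V j)) ** V j))"
      by (intro sum.cong) (simp_all add: right Vj unitary_matD)
    then have "T X = (\<Sum>j<m. v j *\<^sub>R (T (X ** adj (V j)) ** V j))"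
      by (simp only: sum1)
    also have "\<dots> = (\<Sum>j<m. \<Sum>k\<in>UNIV. P (x k) ** X ** (v j *\<^sub>R (adj (V j) ** y k ** V j)))"
      by (simp add: 1 cmat_simps scaleR_sum_right)
    also have "\<dots> = (\<Sum>k\<in>UNIV. P (x k) ** X ** P (y k))"
      unfolding P_def avg_def Ad_def mm.sum_right by (rule sum.swap)
    finally show ?thesis .
  qed
  with PN show ?thesis
    by (intro exI[of _ "\<lambda>k. P (x k)"] exI[of _ "\<lambda>k. P (y k)"]) simp
qed

section \<open>Asymptotics of the semigroup\<close>

lemma norm_choi_le: "norm (choi S - choi T) \<le> (\<Sum>i\<in>UNIV. \<Sum>j\<in>UNIV. norm (S (munit i j) - T (munit i j)))"
proof -
  have le: "norm x \<le> (\<Sum>i\<in>UNIV. norm (x $ i))" for x :: "'v::real_normed_vector^'n"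
    unfolding norm_vec_def by (rule L2_set_le_sum) simp
  have "norm (choi S - choi T) \<le> (\<Sum>i\<in>UNIV. norm ((choi S - choi T) $ i))" by (rule le)
  also have "\<dots> \<le> (\<Sum>i\<in>UNIV. \<Sum>j\<in>UNIV. norm ((choi S - choi T) $ i $ j))" by (intro sum_mono le)
  finally show ?thesis by (simp add: choi_def)
qed

context
  fixes \<Phi> :: "real \<Rightarrow> 'd::finite cmat \<Rightarrow> 'd cmat"
  assumes qds: "quantum_dynamical_semigroup \<Phi>"
begin

lemma qds_channel: "0 \<le> t \<Longrightarrow> unital_channel (\<Phi> t)"
  and qds_zero: "\<Phi> 0 X = X"
  and qds_continuous: "continuous_on {0..} (\<lambda>t. \<Phi> t X)"
  using qds by (simp_all add: quantum_dynamical_semigroup_def)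

lemma qds_add: "0 \<le> s \<Longrightarrow> 0 \<le> t \<Longrightarrow> \<Phi> s (\<Phi> t X) = \<Phi> (s + t) X"
  using qds unfolding quantum_dynamical_semigroup_def by (metis comp_apply)

lemmas qds_linear = channel_linear[OF qds_channel]

section \<open>The algebra on which the semigroup is isometric\<close>

text \<open>The \<open>N\<close> of the introduction, known as the decoherence-free algebra.\<close>

definition isometric_part :: "'d cmat set" where
  "isometric_part = {X. \<forall>t\<ge>0. norm (\<Phi> t X) = norm X}"

lemma isometric_part_iff:
  "X \<in> isometric_part \<longleftrightarrow> (\<forall>t\<ge>0. \<forall>Y. \<Phi> t (Y ** X) = \<Phi> t Y ** \<Phi> t X \<and> \<Phi> t (X ** Y) = \<Phi> t X ** \<Phi> t Y)"
  using norm_channel_iff[OF qds_channel] by (simp add: isometric_part_def)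

lemma isometric_part_mult:
  assumes "X \<in> isometric_part" "0 \<le> t"
  shows "\<Phi> t (Y ** X) = \<Phi> t Y ** \<Phi> t X" "\<Phi> t (X ** Y) = \<Phi> t X ** \<Phi> t Y"
  using assms isometric_part_iff by blast+

text \<open>Adjoints and scalar multiples are read off the norm condition, sums and products off the
  multiplicative one.\<close>

lemma star_algebra_isometric_part: "star_algebra isometric_part"
  unfolding star_algebra_def
proof (intro conjI ballI allI)
  show "mat 1 \<in> isometric_part"
    by (simp add: isometric_part_def channel_one[OF qds_channel])
  fix X assume X: "X \<in> isometric_part"
  show "adj X \<in> isometric_part"
    using X by (simp add: isometric_part_def channel_adj[OF qds_channel])
  show "sm c X \<in> isometric_part" for c
    using X by (simp add: isometric_part_def clinear_mapD[OF qds_linear])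
  fix Y assume Y: "Y \<in> isometric_part"
  show "X + Y \<in> isometric_part"
    using isometric_part_mult[OF X] isometric_part_mult[OF Y]
    by (simp add: isometric_part_iff clinear_mapD[OF qds_linear] cmat_simps)
  show "X ** Y \<in> isometric_part"
    unfolding isometric_part_iff
  proof (intro allI impI conjI)
    fix t Z assume t: "0 \<le> (t::real)"
    note m = isometric_part_mult[OF X t] isometric_part_mult[OF Y t]
    show "\<Phi> t (Z ** (X ** Y)) = \<Phi> t Z ** \<Phi> t (X ** Y)"
      using m(3)[of "Z ** X"] m(1)[of Z] m(3)[of X] by (simp add: matrix_mul_assoc)
    show "\<Phi> t (X ** Y ** Z) = \<Phi> t (X ** Y) ** \<Phi> t Z"
      using m(2)[of "Y ** Z"] m(4)[of Z] m(2)[of Y] by (simp add: matrix_mul_assoc)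
  qed
qed

lemma qds_isometric_part: "X \<in> isometric_part \<Longrightarrow> 0 \<le> s \<Longrightarrow> \<Phi> s X \<in> isometric_part"
  by (simp add: isometric_part_def qds_add)

lemma qds_unitaries:
  assumes V: "V \<in> unitaries isometric_part" and t: "0 \<le> t"
  shows "\<Phi> t V \<in> unitaries isometric_part"
proof -
  note sa = star_algebra_isometric_part
  have VN: "V \<in> isometric_part" using unitariesD(2)[OF sa V] .
  have "adj (\<Phi> t V) ** \<Phi> t V = \<Phi> t (adj V ** V)"
    by (simp add: isometric_part_mult[OF VN t] channel_adj[OF qds_channel[OF t]])
  then have "unitary_mat (\<Phi> t V)"
    using unitary_matD(1)[OF unitariesD(3)[OF sa V]]
    by (intro unitary_matI) (simp add: channel_one[OF qds_channel[OF t]])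
  then show ?thesis
    using qds_isometric_part[OF VN t] by (simp add: unitaries_def)
qed

section \<open>Unitary implementation on this algebra\<close>

text \<open>Entries of a unitary are bounded by the norm of the identity, so continuity at 0 on the
  finitely many matrix units gives a bound uniform in \<open>V\<close>.\<close>

lemma qds_near_identity:
  assumes "0 < \<epsilon>"
  obtains \<tau> where "0 < \<tau>" "\<And>t V. 0 \<le> t \<Longrightarrow> t \<le> \<tau> \<Longrightarrow> unitary_mat V \<Longrightarrow> norm (\<Phi> t V - V) \<le> \<epsilon>"
proof -
  define c where "c = norm (mat 1 :: 'd cmat)"
  define h where "h t = (\<Sum>i\<in>UNIV. \<Sum>j\<in>UNIV. c * norm (\<Phi> t (munit i j) - munit i j))" for t
  have "continuous_on {0..} h"
    unfolding h_def by (intro continuous_intros qds_continuous)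
  moreover have "h 0 = 0" by (simp add: h_def qds_zero)
  ultimately obtain d where d: "0 < d" "\<And>t. 0 \<le> t \<Longrightarrow> dist t 0 < d \<Longrightarrow> dist (h t) 0 < \<epsilon>"
    using assms unfolding continuous_on_iff by (metis atLeast_iff order_refl)
  have "norm (\<Phi> t V - V) \<le> \<epsilon>" if t: "0 \<le> t" "t \<le> d / 2" and V: "unitary_mat V" for t V
  proof -
    have "\<Phi> t V - V = (\<Sum>i\<in>UNIV. \<Sum>j\<in>UNIV. sm (V $ i $ j) (\<Phi> t (munit i j) - munit i j))"
      by (simp add: sm.diff_right sum_subtractf flip: munit_expansion clinear_map_expansion[OF qds_linear[OF t(1)]])
    also have "norm \<dots> \<le> h t"
      unfolding h_def
    proof (intro sum_norm_le)
      fix i j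
      have "cmod (V $ i $ j) \<le> norm V"
        by (meson Finite_Cartesian_Product.norm_nth_le order_trans)
      then show "norm (sm (V $ i $ j) (\<Phi> t (munit i j) - munit i j)) \<le> c * norm (\<Phi> t (munit i j) - munit i j)"
        using norm_unitary[OF V] by (simp add: c_def mult_right_mono)
    qed
    also have "h t \<le> \<epsilon>"
      using d(2)[of t] t d(1) by (simp add: dist_real_def)
    finally show ?thesis .
  qed
  with d(1) that[of "d / 2"] show thesis by simp
qed

text \<open>\<open>unitary_implementation\<close> covers short times. A general \<open>t\<close>
  consists of \<open>k\<close> short steps \<open>s\<close>, and since \<open>\<Phi> s\<close> maps
  the unitaries of \<open>N\<close> to unitaries of \<open>N\<close>, the implementing unitaries
  multiply.\<close>

lemma qds_implementation:
  assumes "0 \<le> t"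
  obtains U where "unitary_mat U" "\<And>V. V \<in> unitaries isometric_part \<Longrightarrow> \<Phi> t V = U ** V ** adj U"
proof -
  note sa = star_algebra_isometric_part
  obtain \<tau> where \<tau>: "0 < \<tau>" "\<And>t V. 0 \<le> t \<Longrightarrow> t \<le> \<tau> \<Longrightarrow> unitary_mat V \<Longrightarrow> norm (\<Phi> t V - V) \<le> 1/5"
    using qds_near_identity[of "1/5"] by auto
  have small: "\<exists>U. unitary_mat U \<and> (\<forall>V\<in>unitaries isometric_part. \<Phi> s V = U ** V ** adj U)"
    if s: "0 \<le> s" "s \<le> \<tau>" for s
  proof -
    have "\<Phi> s (V ** W) = \<Phi> s V ** \<Phi> s W" if "V \<in> unitaries isometric_part" for V W
      using isometric_part_mult(2)[OF unitariesD(2)[OF sa that] s(1)] .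
    then show ?thesis
      using unitary_implementation[OF sa qds_linear[OF s(1)] channel_one[OF qds_channel[OF s(1)]]]
        channel_adj[OF qds_channel[OF s(1)]] \<tau>(2)[OF s] unitariesD(3)[OF sa] by metis
  qed
  have "\<exists>U. unitary_mat U \<and> (\<forall>V\<in>unitaries isometric_part. \<Phi> (real k * s) V = U ** V ** adj U)"
    if s: "0 \<le> s" "s \<le> \<tau>" for s k
  proof (induction k)
    case 0
    show ?case by (rule exI[of _ "mat 1"]) (simp add: qds_zero unitary_mat_one)
  next
    case (Suc k)
    then obtain U where U: "unitary_mat U" "\<And>V. V \<in> unitaries isometric_part \<Longrightarrow> \<Phi> (real k * s) V = U ** V ** adj U"
      by blast
    obtain W where W: "unitary_mat W" "\<And>V. V \<in> unitaries isometric_part \<Longrightarrow> \<Phi> s V = W ** V ** adj W"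
      using small[OF s] by blast
    have "\<Phi> (real (Suc k) * s) V = (U ** W) ** V ** adj (U ** W)" if V: "V \<in> unitaries isometric_part" for V
    proof -
      have "\<Phi> (real (Suc k) * s) V = \<Phi> (real k * s) (\<Phi> s V)"
        using s by (simp add: qds_add algebra_simps)
      also have "\<dots> = U ** \<Phi> s V ** adj U"
        using U(2)[OF qds_unitaries[OF V s(1)]] .
      finally show ?thesis by (simp add: W(2)[OF V] adj_mul matrix_mul_assoc)
    qed
    then show ?case using unitary_mat_mul[OF U(1) W(1)] by blast
  qed
  note mult = this
  obtain k where k: "t / \<tau> < real k" using reals_Archimedean2 by blast
  have "0 < real k" using k \<tau>(1) assms by (metis divide_nonneg_pos le_less_trans)
  then have "0 \<le> t / real k" "t / real k \<le> \<tau>" "real k * (t / real k) = t"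
    using k \<tau>(1) assms by (simp_all add: field_simps)
  then show thesis
    using mult[of "t / real k" k] that by metis
qed

text \<open>Norms decrease along the orbit, so a cluster point \<open>Z\<close> attains their
  infimum, no \<open>\<Phi> s\<close> can shrink it, and \<open>Z\<close> lies in \<open>N\<close>.
  The orbit stays orthogonal to \<open>N\<close>, so \<open>Z = 0\<close>; by monotonicity the whole
  orbit decays.\<close>

lemma qds_decay:
  assumes perp: "\<And>X. X \<in> isometric_part \<Longrightarrow> X \<bullet> M = 0"
  shows "((\<lambda>t. norm (\<Phi> t M)) \<longlongrightarrow> 0) at_top"
proof -
  note sa = star_algebra_isometric_part
  have perp_t: "X \<bullet> \<Phi> t M = 0" if X: "X \<in> isometric_part" and t: "0 \<le> t" for X t
  proof -
    have lin: "linear (\<Phi> t)" using clinear_mapD(3)[OF qds_linear[OF t]] .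
    \<comment> \<open>An isometry of the finite-dimensional \<open>N\<close> into itself is onto. So
      each \<open>X\<close> in \<open>N\<close> is some \<open>\<Phi> t X'\<close>, and
      multiplicativity with trace preservation carries the inner product back to time 0.\<close>
    have "\<Phi> t ` isometric_part = isometric_part"
    proof (rule subspace_dim_equal)
      have "inj_on (\<Phi> t) isometric_part"
      proof (rule inj_onI)
        fix X Y assume "X \<in> isometric_part" "Y \<in> isometric_part" and eq: "\<Phi> t X = \<Phi> t Y"
        then have "X - Y \<in> isometric_part" by (simp add: star_algebraD[OF sa])
        then have "norm (X - Y) = norm (\<Phi> t (X - Y))" using t by (simp add: isometric_part_def)
        also have "\<Phi> t (X - Y) = 0" using eq by (simp add: clinear_map_diff[OF qds_linear[OF t]])
        finally show "X = Y" by simp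
      qed
      then have "inj_on (\<Phi> t) (span isometric_part)"
        using subspace_star_algebra[OF sa] by (simp add: span_eq_iff[THEN iffD2])
      then show "dim isometric_part \<le> dim (\<Phi> t ` isometric_part)"
        using dim_image_eq[OF lin, of isometric_part] by simp
      show "subspace (\<Phi> t ` isometric_part)" "subspace isometric_part"
        using linear_subspace_image[OF lin] subspace_star_algebra[OF sa] by auto
      show "\<Phi> t ` isometric_part \<subseteq> isometric_part"
        using qds_isometric_part t by blast
    qed
    then obtain X' where X': "X' \<in> isometric_part" "X = \<Phi> t X'" using X by (metis imageE)
    have "adj X' \<in> isometric_part" using X'(1) star_algebraD(4)[OF sa] by blast
    then have "adj X ** \<Phi> t M = \<Phi> t (adj X' ** M)"
      using t by (simp add: isometric_part_mult X'(2) channel_adj[OF qds_channel])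
    then show ?thesis
      using perp[OF X'(1)] by (simp add: inner_cmat channel_trace[OF qds_channel[OF t]])
  qed
  have mono: "norm (\<Phi> t M) \<le> norm (\<Phi> s M)" if "0 \<le> s" "s \<le> t" for s t
    using channel_contraction[OF qds_channel[of "t - s"], of "\<Phi> s M"] qds_add[of "t - s" s M] that by simp
  have "bounded (range (\<lambda>n. \<Phi> (real n) M))"
    unfolding bounded_iff using mono[of 0] by (intro exI[of _ "norm M"]) (auto simp: qds_zero)
  then obtain Z r where r: "strict_mono r" "((\<lambda>n. \<Phi> (real n) M) \<circ> r) \<longlonglongrightarrow> Z"
    using bounded_imp_convergent_subsequence by blast
  then have lim: "(\<lambda>n. \<Phi> (real (r n)) M) \<longlonglongrightarrow> Z" by (simp add: o_def)
  have le: "norm Z \<le> norm (\<Phi> t M)" if t: "0 \<le> t" for t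
  proof (rule LIMSEQ_le_const2[OF tendsto_norm[OF lim]])
    obtain n where "t \<le> real n" using real_arch_simple by blast
    then have "t \<le> real (r m)" if "n \<le> m" for m
      using that seq_suble[OF r(1), of m] by linarith
    then show "\<exists>n. \<forall>m\<ge>n. norm (\<Phi> (real (r m)) M) \<le> norm (\<Phi> t M)"
      using mono[OF t] by blast
  qed
  have "Z \<in> isometric_part"
    unfolding isometric_part_def
  proof (intro CollectI allI impI antisym)
    fix s :: real assume s: "0 \<le> s"
    show "norm (\<Phi> s Z) \<le> norm Z" by (rule channel_contraction[OF qds_channel[OF s]])
    have "(\<lambda>n. norm (\<Phi> s (\<Phi> (real (r n)) M))) \<longlonglongrightarrow> norm (\<Phi> s Z)"
      by (intro tendsto_norm bounded_linear.tendsto[OF clinear_mapD(4)[OF qds_linear[OF s]]] lim)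
    \<comment> \<open>The approximants lie on the orbit at times \<open>s + r n\<close>, where
      \<open>le\<close> bounds the norm from below.\<close>
    then show "norm Z \<le> norm (\<Phi> s Z)"
      by (rule LIMSEQ_le_const) (use s le in \<open>auto simp: qds_add\<close>)
  qed
  then have "Z \<bullet> \<Phi> (real (r n)) M = 0" for n
    using perp_t by simp
  moreover have "(\<lambda>n. Z \<bullet> \<Phi> (real (r n)) M) \<longlonglongrightarrow> Z \<bullet> Z"
    by (intro tendsto_inner tendsto_const lim)
  ultimately have "Z \<bullet> Z = 0" by (simp add: LIMSEQ_const_iff)
  then have lim0: "(\<lambda>n. norm (\<Phi> (real (r n)) M)) \<longlonglongrightarrow> 0"
    using tendsto_norm[OF lim] by simp
  show ?thesis
  proof (rule tendstoI)
    fix e :: real assume "0 < e"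
    from order_tendstoD(2)[OF lim0 this] obtain n where "norm (\<Phi> (real (r n)) M) < e"
      unfolding eventually_sequentially by blast
    then have "norm (\<Phi> t M) < e" if "real (r n) \<le> t" for t
      using mono[of "real (r n)" t] that by simp
    then show "\<forall>\<^sub>F t in at_top. dist (norm (\<Phi> t M)) 0 < e"
      unfolding eventually_at_top_linorder by (intro exI[of _ "real (r n)"]) simp
  qed
qed

text \<open>Conjugation by \<open>Y\<close> undoes the automorphism of \<open>N\<close>, so the
  composite is an \<open>N\<close>-bimodule map with coefficients in the commutant. Unitality and
  trace preservation become the sum conditions of \<open>sandwich_sum_in_affine_hull\<close>; with
  \<open>avg_tracial\<close> the second one also shows that the invariant average absorbs the
  composite.\<close>

lemma twisted_channel:
  assumes t: "0 \<le> t" and Y: "unitary_mat Y"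
    and impl: "\<And>V. V \<in> unitaries isometric_part \<Longrightarrow> \<Phi> t V = Y ** V ** adj Y"
  shows "clinear_map (\<lambda>X. Ad Y (\<Phi> t X))"
    and "choi (\<lambda>X. Ad Y (\<Phi> t X)) \<in> affine hull (Ad_hull (commutant isometric_part))"
    and "X \<in> isometric_part \<Longrightarrow> Ad Y (\<Phi> t X) = X"
    and "(\<And>V X. V \<in> unitaries (commutant isometric_part) \<Longrightarrow> avg n w U (Ad V X) = avg n w U X) \<Longrightarrow>
      avg n w U (Ad Y (\<Phi> t X)) = avg n w U X"
proof -
  note sa = star_algebra_isometric_part
  note sc = star_algebra_commutant[OF sa]
  define T where "T X = Ad Y (\<Phi> t X)" for X
  have cl: "clinear_map T"
    by (simp add: clinear_map_def T_def clinear_mapD[OF qds_linear[OF t]] clinear_mapD[OF clinear_map_Ad])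
  then show "clinear_map (\<lambda>X. Ad Y (\<Phi> t X))" by (simp add: T_def[abs_def])
  have VN: "V \<in> isometric_part" if "V \<in> unitaries isometric_part" for V
    using unitariesD(2)[OF sa that] .
  have left: "T (V ** X) = V ** T X" and right: "T (X ** V) = T X ** V"
    if V: "V \<in> unitaries isometric_part" for V X
    by (simp_all add: T_def Ad_def isometric_part_mult[OF VN[OF V] t] impl[OF V] matrix_mul_assoc unitary_matD[OF Y])
  have one: "T (mat 1) = mat 1"
    by (simp add: T_def Ad_def channel_one[OF qds_channel[OF t]] unitary_matD[OF Y])
  show "Ad Y (\<Phi> t X) = X" if "X \<in> isometric_part"
  proof -
    have "T X - X = 0"
    proof (rule star_algebra_linear_induct[OF sa that, of "\<lambda>X. T X - X"])
      show "bounded_linear (\<lambda>X. T X - X)"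
        by (intro bounded_linear_sub clinear_mapD(4)[OF cl] bounded_linear_ident)
      show "T V - V = 0" if "V \<in> unitaries isometric_part" for V
        using left[OF that, of "mat 1"] by (simp add: one)
    qed (simp add: clinear_mapD[OF cl] sm.diff_right)
    then show ?thesis by (simp add: T_def)
  qed
  obtain a b :: "'d \<times> 'd \<times> 'd \<times> 'd \<Rightarrow> 'd cmat"
    where ab: "\<And>k. a k \<in> commutant isometric_part \<and> b k \<in> commutant isometric_part"
      "\<And>X. T X = (\<Sum>k\<in>UNIV. a k ** X ** b k)"
    using bimodule_map_representation[OF sa cl left right] by blast
  have unital: "(\<Sum>k\<in>UNIV. a k ** b k) = mat 1"
    using ab(2)[of "mat 1"] by (simp add: one)
  \<comment> \<open>The sum is the image of the identity under the trace dual of \<open>T\<close>,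
    so it is 1 because \<open>T\<close> preserves the trace.\<close>
  have tp: "(\<Sum>k\<in>UNIV. b k ** a k) = mat 1"
  proof (rule cmat_eqI_trace)
    fix X
    have "trace (X ** (\<Sum>k\<in>UNIV. b k ** a k)) = (\<Sum>k\<in>UNIV. trace (a k ** X ** b k))"
      unfolding mm.sum_right trace_sum
      by (intro sum.cong refl) (metis trace_mul_sym matrix_mul_assoc)
    also have "\<dots> = trace (T X)" by (simp add: ab(2) trace_sum)
    also have "\<dots> = trace (\<Phi> t X)"
      using trace_mul_sym[of "adj Y ** \<Phi> t X" Y] by (simp add: T_def Ad_def matrix_mul_assoc unitary_matD[OF Y])
    finally show "trace (X ** (\<Sum>k\<in>UNIV. b k ** a k)) = trace (X ** mat 1)"
      by (simp add: channel_trace[OF qds_channel[OF t]])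
  qed
  have "choi T \<in> affine hull (Ad_hull (commutant isometric_part))"
    using ab(1) by (intro sandwich_sum_in_affine_hull[OF sc _ ab(2) unital tp])
      (auto simp: T_def channel_adj[OF qds_channel[OF t]] adj_Ad)
  then show "choi (\<lambda>X. Ad Y (\<Phi> t X)) \<in> affine hull (Ad_hull (commutant isometric_part))"
    by (simp add: T_def[abs_def])
  show "avg n w U (Ad Y (\<Phi> t X)) = avg n w U X"
    if inv: "\<And>V X. V \<in> unitaries (commutant isometric_part) \<Longrightarrow> avg n w U (Ad V X) = avg n w U X"
  proof -
    have "avg n w U (T X) = (\<Sum>k\<in>UNIV. avg n w U (a k ** (X ** b k)))"
      by (simp add: ab(2) clinear_map_sum[OF clinear_map_avg] matrix_mul_assoc)
    also have "\<dots> = (\<Sum>k\<in>UNIV. avg n w U (X ** b k ** a k))"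
      by (intro sum.cong refl avg_tracial[OF sc _ inv]) (use ab(1) in auto)
    also have "\<dots> = avg n w U (X ** (\<Sum>k\<in>UNIV. b k ** a k))"
      by (simp add: clinear_map_sum[OF clinear_map_avg] mm.sum_right matrix_mul_assoc)
    finally show ?thesis by (simp add: tp T_def)
  qed
qed

end

section \<open>Convergence to the invariant average\<close>

lemma mixed_unitary_Ad:
  fixes \<Psi> :: "'d::finite cmat \<Rightarrow> 'd cmat"
  assumes "unitary_mat Y" "mixed_unitary (\<lambda>X. Ad Y (\<Psi> X))"
  shows "mixed_unitary \<Psi>"
proof -
  obtain l w and W :: "nat \<Rightarrow> 'd cmat" where W: "\<And>j. j < l \<Longrightarrow> 0 \<le> w j \<and> unitary_mat (W j)" "(\<Sum>j<l. w j) = 1"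
    "\<And>X. Ad Y (\<Psi> X) = (\<Sum>j<l. w j *\<^sub>R Ad (W j) X)"
    using assms(2) unfolding mixed_unitary_def by blast
  have "\<Psi> X = (\<Sum>j<l. w j *\<^sub>R Ad (W j ** adj Y) X)" for X
  proof -
    have "\<Psi> X = Ad (adj Y) (Ad Y (\<Psi> X))"
      using assms(1) by (simp add: Ad_comp unitary_matD)
    also have "\<dots> = (\<Sum>j<l. w j *\<^sub>R Ad (adj Y) (Ad (W j) X))"
      by (simp add: W(3) clinear_map_sum[OF clinear_map_Ad] clinear_map_scaleR[OF clinear_map_Ad])
    finally show ?thesis by (simp add: Ad_comp)
  qed
  then show ?thesis
    unfolding mixed_unitary_def using W(1,2) unitary_mat_mul[OF _ unitary_mat_adj[OF assms(1)]]
    by (intro exI[of _ l] exI[of _ w] exI[of _ "\<lambda>j. W j ** adj Y"]) auto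
qed

theorem theorem4p6:
  fixes \<Phi> :: "real \<Rightarrow> complex^'d^'d \<Rightarrow> complex^'d^'d"
  assumes "quantum_dynamical_semigroup \<Phi>"
  shows "\<exists>t0\<ge>0. \<forall>t\<ge>t0. mixed_unitary (\<Phi> t)"
proof -
  define N where "N = isometric_part \<Phi>"
  have sa: "star_algebra N" unfolding N_def by (rule star_algebra_isometric_part[OF assms])
  have sc: "star_algebra (commutant N)" by (rule star_algebra_commutant[OF sa])
  obtain n w U \<epsilon> where U: "unitary_weights (commutant N) n w U" and \<epsilon>: "\<epsilon> > 0"
    and right: "\<And>V X. V \<in> unitaries (commutant N) \<Longrightarrow> avg n w U (Ad V X) = avg n w U X"
    and near: "\<And>T. clinear_map T \<Longrightarrow> choi T \<in> affine hull (Ad_hull (commutant N)) \<Longrightarrow>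
      dist (choi T) (choi (avg n w U)) < \<epsilon> \<Longrightarrow> mixed_unitary T"
    by (rule mixed_unitary_near_avg[OF sc]) blast
  define E where "E = avg n w U"
  have clE: "clinear_map E" by (simp add: E_def clinear_map_avg)
  have "\<exists>Y. unitary_mat Y \<and> (\<forall>V\<in>unitaries N. \<Phi> t V = Y ** V ** adj Y)" if "0 \<le> t" for t
    using qds_implementation[OF assms that] unfolding N_def by metis
  then obtain Y where Y: "\<And>t. 0 \<le> t \<Longrightarrow> unitary_mat (Y t)"
    "\<And>t V. 0 \<le> t \<Longrightarrow> V \<in> unitaries N \<Longrightarrow> \<Phi> t V = Y t ** V ** adj (Y t)"
    by metis
  define T where "T t X = Ad (Y t) (\<Phi> t X)" for t X
  have tw: "clinear_map (T t)" "choi (T t) \<in> affine hull (Ad_hull (commutant N))"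
    "\<And>X. X \<in> N \<Longrightarrow> T t X = X" "\<And>X. E (T t X) = E X" if t: "0 \<le> t" for t
  proof -
    note tw = twisted_channel[OF assms t Y(1)[OF t], folded N_def, OF Y(2)[OF t], simplified]
    show "clinear_map (T t)" "choi (T t) \<in> affine hull (Ad_hull (commutant N))"
      "\<And>X. X \<in> N \<Longrightarrow> T t X = X" "\<And>X. E (T t X) = E X"
      unfolding T_def[abs_def] E_def using tw right by auto
  qed
  have E_fix: "E X = X" if "X \<in> N" for X
    unfolding E_def
  proof (rule avg_fixed[OF U])
    fix j assume "j < n"
    then have "U j \<in> unitaries (commutant N)" using U by (simp add: unitary_weights_def)
    then have "U j ** X = X ** U j" "unitary_mat (U j)"
      using that unfolding unitaries_def commutant_def by blast+
    then show "Ad (U j) X = X"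
      by (metis Ad_def matrix_mul_assoc matrix_mul_lid unitary_matD(1))
  qed
  \<comment> \<open>Split \<open>X = P + Q\<close> with \<open>P\<close> in \<open>N\<close> and
    \<open>Q\<close> orthogonal to it. \<open>T t\<close> and \<open>E\<close> both fix
    \<open>P\<close>, while \<open>T t Q\<close> decays. Since \<open>E Q = E (T t Q)\<close> for
    all \<open>t \<ge> 0\<close>, also \<open>E Q = 0\<close>.\<close>
  have lim: "((\<lambda>t. norm (T t X - E X)) \<longlongrightarrow> 0) at_top" for X
  proof -
    obtain P Q where PQ: "P \<in> span N" "\<And>Z. Z \<in> span N \<Longrightarrow> orthogonal Q Z" "X = P + Q"
      using orthogonal_subspace_decomp_exists[of N X] by metis
    have P: "P \<in> N" using PQ(1) subspace_star_algebra[OF sa] by (metis span_eq_iff)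
    have decay: "((\<lambda>t. norm (\<Phi> t Q)) \<longlongrightarrow> 0) at_top"
      using PQ(2) span_base by (intro qds_decay[OF assms]) (auto simp: orthogonal_def inner_commute N_def[symmetric])
    have T_norm: "norm (T t Q) = norm (\<Phi> t Q)" if "0 \<le> t" for t
      using Y(1)[OF that] by (simp add: T_def norm_Ad)
    have "((\<lambda>t. norm (T t Q)) \<longlongrightarrow> 0) at_top"
      by (rule Lim_transform_eventually[OF decay])
        (use T_norm in \<open>auto intro!: eventually_mono[OF eventually_ge_at_top[of 0]]\<close>)
    then have TQ: "((\<lambda>t. T t Q) \<longlongrightarrow> 0) at_top" by (rule tendsto_norm_zero_cancel)
    have "((\<lambda>t. E (T t Q)) \<longlongrightarrow> E 0) at_top"
      by (intro bounded_linear.tendsto[OF clinear_mapD(4)[OF clE]] TQ)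
    moreover have "\<forall>\<^sub>F t in at_top. E (T t Q) = E Q"
      by (rule eventually_mono[OF eventually_ge_at_top[of 0]]) (use tw(4) right in \<open>simp add: E_def\<close>)
    ultimately have "((\<lambda>t::real. E Q) \<longlongrightarrow> E 0) at_top"
      by (rule Lim_transform_eventually)
    then have EQ: "E Q = 0"
      by (simp add: tendsto_const_iff clinear_map_zero[OF clE])
    have "T t X - E X = T t Q" if "0 \<le> t" for t
      by (simp add: PQ(3) clinear_mapD(1)[OF tw(1)[OF that]] clinear_mapD(1)[OF clE] tw(3)[OF that P] E_fix[OF P] EQ)
    then show ?thesis
      by (intro Lim_transform_eventually[OF tendsto_norm_zero[OF TQ]])
        (auto intro!: eventually_mono[OF eventually_ge_at_top[of 0]])
  qed
  \<comment> \<open>Convergence on the finitely many matrix units controls the distance of the Choi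
    matrices, so one threshold brings \<open>T t\<close> within \<open>\<epsilon>\<close> of
    \<open>E\<close> for all later times.\<close>
  have "((\<lambda>t. \<Sum>i\<in>UNIV. \<Sum>j\<in>UNIV. norm (T t (munit i j) - E (munit i j))) \<longlongrightarrow> (\<Sum>i\<in>(UNIV::'d set). \<Sum>j\<in>(UNIV::'d set). 0)) at_top"
    by (intro tendsto_sum lim)
  then have "\<forall>\<^sub>F t in at_top. (\<Sum>i\<in>UNIV. \<Sum>j\<in>UNIV. norm (T t (munit i j) - E (munit i j))) < \<epsilon>"
    using \<epsilon> by (intro order_tendstoD(2)) auto
  then obtain t1 where t1: "\<And>t. t \<ge> t1 \<Longrightarrow> (\<Sum>i\<in>UNIV. \<Sum>j\<in>UNIV. norm (T t (munit i j) - E (munit i j))) < \<epsilon>"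
    unfolding eventually_at_top_linorder by blast
  have "mixed_unitary (\<Phi> t)" if t: "max 0 t1 \<le> t" for t
  proof -
    have t0: "0 \<le> t" using t by simp
    have "dist (choi (T t)) (choi E) < \<epsilon>"
      using norm_choi_le[of "T t" E] t1[of t] t unfolding dist_norm by linarith
    then have "mixed_unitary (T t)"
      using near[OF tw(1,2)[OF t0]] by (simp add: E_def)
    then show ?thesis
      using mixed_unitary_Ad[OF Y(1)[OF t0]] by (simp add: T_def[abs_def])
  qed
  then show ?thesis by (intro exI[of _ "max 0 t1"]) auto
qed

end
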